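(* For every integer $m\ge1$, \[ \triangle(q)^{4m^2}=\frac{(2m-1)!}{2^{m-1}m!(m-1)!\left(\prod_{i=1}^m(2i-1)!\right)^2}\sum_{J\subset\{1,\dots,m\}}(-1)^{|J|}\sum_{\vec k,\vec r\in\mathbb{Z}^m_J}q^{\sum_{j=1}^m(2(k_j^2+k_jr_j-k_j)-r_j)-\frac{m(m-1)}{2}}\prod_{i=1}^m(r_i+2k_i-1) \] \[ \times\prod_{1\le i<j\le m}(r_i-r_j)(r_i+r_j)(r_i+2k_i-r_j-2k_j)(r_i+2k_i+r_j+2k_j-2). \]
   Context: $\triangle(q)=\sum_{n\ge0}q^{n(n+1)/2}$. For $J\subset\{1,\dots,m\}$, $\mathbb{Z}^m_J=\{\vec k=(k_1,\dots,k_m)\in\mathbb{Z}^m : J=\{j: k_j\le 0\}\}$; the inner sum is over pairs $\vec k=(k_1,\dots,k_m)$, $\vec r=(r_1,\dots,r_m)$ both in $\mathbb{Z}^m_J$. *)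

theory Defs
  imports "HOL-Analysis.Analysis"
begin

definition triangle_series :: "complex \<Rightarrow> complex" where
  "triangle_series q = (\<Sum>n. q ^ (n * (n + 1) div 2))"

(* Elements of Z^m are the extensional functions on the index set {1..m}, so that each
   vector is represented exactly once. *)
definition int_vecs_sign :: "nat \<Rightarrow> nat set \<Rightarrow> (nat \<Rightarrow> int) set" where
  "int_vecs_sign m J = {k \<in> {1..m} \<rightarrow>\<^sub>E UNIV. J = {j \<in> {1..m}. k j \<le> 0}}"

definition q_exponent :: "nat \<Rightarrow> (nat \<Rightarrow> int) \<Rightarrow> (nat \<Rightarrow> int) \<Rightarrow> int" where
  "q_exponent m k r =
     (\<Sum>j=1..m. 2 * ((k j)\<^sup>2 + k j * r j - k j) - r j) - int m * (int m - 1) div 2"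

definition poly_factor :: "nat \<Rightarrow> (nat \<Rightarrow> int) \<Rightarrow> (nat \<Rightarrow> int) \<Rightarrow> int" where
  "poly_factor m k r =
     (\<Prod>i=1..m. r i + 2 * k i - 1) *
     (\<Prod>(i, j) \<in> {(i, j). 1 \<le> i \<and> i < j \<and> j \<le> m}.
        (r i - r j) * (r i + r j) *
        (r i + 2 * k i - r j - 2 * k j) * (r i + 2 * k i + r j + 2 * k j - 2))"

(* For k, r in the same Z^m_J, a negative exponent forces poly_factor m k r = 0, so the
   convention 0 powi e = 0 for e < 0 is harmless and q = 0 need not be excluded. *)
definition q_term :: "nat \<Rightarrow> complex \<Rightarrow> (nat \<Rightarrow> int) \<Rightarrow> (nat \<Rightarrow> int) \<Rightarrow> complex" where
  "q_term m q k r = q powi q_exponent m k r * of_int (poly_factor m k r)"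

end

theory Submission
  imports Defs "HOL-Computational_Algebra.Formal_Power_Series" "Jordan_Normal_Form.Determinant"
begin

text \<open>
  Put \<open>s = r + 2k - 1\<close> and \<open>q = p\<^sup>2\<close>. The exponent becomes \<open>(\<Sum>(s\<^sub>j\<^sup>2 - r\<^sub>j\<^sup>2) - m\<^sup>2) / 2\<close> and the polynomial factor
  becomes the product of a Vandermonde determinant in the \<open>s\<^sub>j\<^sup>2\<close>, one in the \<open>r\<^sub>j\<^sup>2\<close>, and \<open>\<Prod>s\<^sub>j\<close>.
  By Andreief's identity the multiple sum is \<open>m!\<close> times the determinant of the moments
  \<open>\<Sum> p\<^bsup>s\<^sup>2 - r\<^sup>2\<^esup> s\<^bsup>2i+1\<^esup> r\<^bsup>2j\<^esup>\<close> over \<open>0 \<le> |r| < s\<close> with \<open>s + r\<close> odd. The exponential generating function of these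
  moments is of Kronecker type: multiplied by \<open>A(x)A(y) - C(x)C(y)\<close>, where \<open>A\<close> and \<open>C\<close> are the theta
  series over the even and the odd integers, it depends on \<open>x\<close> alone. Hence it is a Cauchy kernel, whose
  coefficient matrix factors into triangular matrices. The diagonal entries are theta constants, which
  reduce to \<open>p \<triangle>(q)\<^sup>4\<close> by two-dimensional lattice identities iterated along \<open>q, q\<^sup>2, q\<^sup>4, \<dots>\<close>. The
  case \<open>q = 0\<close> follows by continuity.
\<close>

subsection \<open>Summation over the integers\<close>

text \<open>For \<open>k\<close>, \<open>r\<close> of equal sign, \<open>s\<close> has the sign of
  \<open>k\<close> and \<open>|r| < |s|\<close>. So \<open>(-1)^|J|\<close> merely replaces each
  factor \<open>s_j\<close> by \<open>|s_j|\<close>, and the sums over all \<open>J\<close> merge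
  into one sum over the m-th power of a plane cone, the shape that Andreief's identity requires. The
  form \<open>s^2 - r^2\<close> is indefinite. Multiplication by the theta kernel adds a definite
  form whose second square cancels the negative one, so that the inner sums become finite geometric
  sums. The exponent \<open>4 m^2\<close> arises because the n-th diagonal entries together
  contribute \<open>T^(2n+1)\<close> with \<open>T = p * triangle_series (p^2) ^ 4\<close>, and the
  first m odd numbers add up to \<open>m^2\<close>. The resulting \<open>p^(m^2)\<close> cancels the
  shift by \<open>m^2\<close> in the exponent. The obstacle at \<open>q = 0\<close> is that some
  exponents are negative. If the polynomial factor is nonzero, the \<open>|s_j|\<close> are
  distinct, and this forces a nonnegative exponent.\<close>

lemma has_sum_product:
  fixes f :: "'a \<Rightarrow> complex" and g :: "'b \<Rightarrow> complex"
  assumes "f summable_on A" "g summable_on B"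
  shows "((\<lambda>(x, y). f x * g y) has_sum (infsum f A * infsum g B)) (A \<times> B)"
proof (rule has_sum_SigmaI)
  show "((\<lambda>y. case (x, y) of (x, y) \<Rightarrow> f x * g y) has_sum f x * infsum g B) B" for x
    using has_sum_cmult_right[OF has_sum_infsum[OF assms(2)]] by simp
  show "((\<lambda>x. f x * infsum g B) has_sum infsum f A * infsum g B) A"
    using has_sum_cmult_left[OF has_sum_infsum[OF assms(1)]] by simp
  have F: "(\<lambda>x. norm (f x)) summable_on A" and G: "(\<lambda>x. norm (g x)) summable_on B"
    using assms by (simp_all add: summable_on_iff_abs_summable_on_complex)
  have "(\<lambda>x. norm (case x of (x, y) \<Rightarrow> f x * g y)) summable_on A \<times> B"
    unfolding Infinite_Sum.abs_summable_on_Sigma_iff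
  proof (intro conjI ballI)
    show "(\<lambda>y. norm (case (x, y) of (x, y) \<Rightarrow> f x * g y)) summable_on B" for x
      using G by (simp add: norm_mult summable_on_cmult_right)
    show "(\<lambda>x. norm (\<Sum>\<^sub>\<infinity>y\<in>B. norm (case (x, y) of (x, y) \<Rightarrow> f x * g y))) summable_on A"
      using F by (auto simp add: norm_mult infsum_cmult_right' abs_mult intro!: summable_on_cmult_left)
  qed
  thus "(\<lambda>(x, y). f x * g y) summable_on A \<times> B"
    by (rule abs_summable_summable)
qed

lemmas summable_on_product = has_sum_product[THEN has_sum_imp_summable]

lemma summable_power_times_geometric:
  fixes x :: real
  assumes "\<bar>x\<bar> < 1"
  shows "summable (\<lambda>n. (real n + 1) ^ i * x ^ n)"
  using assms
proof (induction i arbitrary: x)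
  case 0
  then show ?case by (simp add: summable_geometric)
next
  case (Suc i)
  have "summable (\<lambda>n. real n ^ i * y ^ n)" if "norm y < 1" for y
    using Suc.IH[of y] that summable_powser_split_head[of "\<lambda>n. real n ^ i" y]
    by (simp add: add.commute)
  hence "summable (\<lambda>n. diffs (\<lambda>n. real n ^ i) n * x ^ n)"
    using Suc.prems by (intro termdiff_converges[of x 1]) auto
  thus ?case by (simp add: diffs_def add.commute)
qed

lemma summable_on_int_power_times_geometric:
  fixes x :: real
  assumes "0 \<le> x" "x < 1"
  shows "(\<lambda>n::int. (\<bar>real_of_int n\<bar> + 1) ^ i * x ^ nat \<bar>n\<bar>) summable_on UNIV"
proof -
  let ?f = "\<lambda>n::int. (\<bar>real_of_int n\<bar> + 1) ^ i * x ^ nat \<bar>n\<bar>"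
  have "summable (\<lambda>n. (real n + 1) ^ i * x ^ n)"
    using assms by (intro summable_power_times_geometric) auto
  hence *: "(\<lambda>n. (real n + 1) ^ i * x ^ n) summable_on UNIV"
    using assms by (intro summable_nonneg_imp_summable_on) auto
  have "?f summable_on range int"
    using * by (subst summable_on_reindex) (auto simp: o_def)
  moreover have "?f summable_on range (\<lambda>n. - int n)"
    using * by (subst summable_on_reindex) (auto simp: o_def inj_on_def)
  ultimately have "?f summable_on (range int \<union> range (\<lambda>n. - int n))"
    by (rule summable_on_union)
  moreover have "range int \<union> range (\<lambda>n. - int n) = UNIV"
    by (metis (mono_tags, lifting) UNIV_eq_I Un_iff int_cases2 rangeI)
  ultimately show ?thesis by simp
qed

lemma norm_powi_le:
  fixes q :: complex
  assumes "q \<noteq> 0" "norm q < 1" "e \<ge> \<bar>n\<bar> - int B"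
  shows "norm (q powi e) \<le> norm q powi (- int B) * norm q ^ nat \<bar>n\<bar>"
proof -
  have "norm (q powi e) = norm q powi e" by (simp add: norm_power_int)
  also have "\<dots> \<le> norm q powi (- int B + \<bar>n\<bar>)"
    using assms by (intro power_int_decreasing) auto
  also have "\<dots> = norm q powi (- int B) * norm q ^ nat \<bar>n\<bar>"
    using assms by (subst power_int_add) (auto simp: power_int_def)
  finally show ?thesis .
qed

text \<open>Linear growth of the exponent up to a slack \<open>B\<close> already gives a geometric
  majorant, so this one bound serves all one-variable theta series with polynomially bounded
  coefficients.\<close>

lemma summable_on_int_powi:
  fixes q :: complex and c :: "int \<Rightarrow> complex"
  assumes q: "q \<noteq> 0" "norm q < 1" and e: "\<And>n. e n \<ge> \<bar>n\<bar> - int B"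
    and c: "\<And>n. norm (c n) \<le> C * (\<bar>real_of_int n\<bar> + 1) ^ i"
  shows "(\<lambda>n. c n * q powi e n) summable_on UNIV"
proof (rule abs_summable_summable[OF Infinite_Sum.abs_summable_on_comparison_test'])
  show "(\<lambda>n::int. (C * norm q powi (- int B)) * ((\<bar>real_of_int n\<bar> + 1) ^ i * norm q ^ nat \<bar>n\<bar>))
     summable_on UNIV"
    using q by (intro summable_on_cmult_right summable_on_int_power_times_geometric) auto
  have C: "C \<ge> 0" using c[of 0] by (auto intro: order_trans[OF norm_ge_zero])
  show "norm (c n * q powi e n)
      \<le> (C * norm q powi (- int B)) * ((\<bar>real_of_int n\<bar> + 1) ^ i * norm q ^ nat \<bar>n\<bar>)" for n
    using mult_mono[OF c norm_powi_le[OF q e]] C by (simp add: norm_mult mult_ac)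
qed

text \<open>Pairs of equal parity are exactly the \<open>(k + l, k - l)\<close>. The pairs of
  opposite parity are written with \<open>l - k - 1 = -1 - (k - l)\<close>, because
  \<open>tri\<close> is invariant under \<open>n -> -1 - n\<close>; for series in \<open>tri\<close>
  both halves then have the same exponent.\<close>

lemma infsum_int_pair_parity_split:
  fixes F :: "int \<times> int \<Rightarrow> complex"
  assumes "F summable_on UNIV"
  shows "infsum F UNIV =
      (\<Sum>\<^sub>\<infinity>(k, l)\<in>UNIV. F (k + l, k - l)) + (\<Sum>\<^sub>\<infinity>(k, l)\<in>UNIV. F (k + l, l - k - 1))"
proof -
  let ?E = "{(a, b). even (a + b :: int)}" and ?O = "{(a, b). odd (a + b :: int)}"
  have "infsum F UNIV = infsum F (?E \<union> ?O)"
    by (rule arg_cong[of _ _ "infsum F"]) auto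
  also have "\<dots> = infsum F ?E + infsum F ?O"
    by (intro infsum_Un_disjoint summable_on_subset[OF assms]) auto
  also have "infsum F ?E = (\<Sum>\<^sub>\<infinity>(k, l)\<in>UNIV. F (k + l, k - l))"
    proof (rule infsum_reindex_bij_witness[of _ "\<lambda>(k, l). (k + l, k - l)"
          "\<lambda>(a, b). ((a + b) div 2, (a - b) div 2)"], goal_cases)
    case (1 x)
    then obtain a b where ab: "x = (a, b)" "even (a + b)" by auto
    then obtain c where "a + b = 2 * c" by (elim evenE)
    hence "b = 2 * c - a" by simp
    with ab show ?case by (simp add: field_simps)
  next
    case (5 x)
    then obtain a b where ab: "x = (a, b)" "even (a + b)" by auto
    then obtain c where "a + b = 2 * c" by (elim evenE)
    hence "b = 2 * c - a" by simp
    with ab show ?case by (simp add: field_simps)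
  qed auto
  also have "infsum F ?O = (\<Sum>\<^sub>\<infinity>(k, l)\<in>UNIV. F (k + l, l - k - 1))"
  proof (rule infsum_reindex_bij_witness[of _ "\<lambda>(k, l). (k + l, l - k - 1)"
          "\<lambda>(a, b). ((a - b - 1) div 2, (a + b + 1) div 2)"], goal_cases)
    case (1 x)
    then obtain a b where ab: "x = (a, b)" "odd (a + b)" by auto
    then obtain c where "a + b = 2 * c + 1" by (elim oddE)
    hence "b = 2 * c + 1 - a" by simp
    with ab show ?case by (simp add: field_simps)
  next
    case (5 x)
    then obtain a b where ab: "x = (a, b)" "odd (a + b)" by auto
    then obtain c where "a + b = 2 * c + 1" by (elim oddE)
    hence "b = 2 * c + 1 - a" by simp
    with ab show ?case by (simp add: field_simps)
  qed auto
  finally show ?thesis .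
qed

lemma summable_on_int_pair_even:
  fixes F :: "int \<times> int \<Rightarrow> complex"
  assumes "F summable_on UNIV"
  shows "(\<lambda>(k, l). F (k + l, k - l)) summable_on UNIV"
proof -
  have "(F \<circ> (\<lambda>(k, l). (k + l, k - l))) summable_on UNIV"
    by (subst summable_on_reindex[symmetric])
       (auto simp: inj_on_def intro: summable_on_subset[OF assms])
  thus ?thesis by (simp add: o_def case_prod_unfold)
qed

subsection \<open>Theta constants\<close>

definition tri :: "int \<Rightarrow> int" where "tri n = n * (n + 1) div 2"
definition alt_sign :: "int \<Rightarrow> complex" where "alt_sign n = (if even n then 1 else - 1)"

definition \<theta>3 :: "complex \<Rightarrow> complex" where "\<theta>3 q = (\<Sum>\<^sub>\<infinity>n. q powi (n\<^sup>2))"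
definition \<theta>4 :: "complex \<Rightarrow> complex" where "\<theta>4 q = (\<Sum>\<^sub>\<infinity>n. alt_sign n * q powi (n\<^sup>2))"
text \<open>The indices \<open>n\<close> and \<open>-1 - n\<close> give the same term, so this is
  twice the triangle series.\<close>

definition \<psi> :: "complex \<Rightarrow> complex" where "\<psi> q = (\<Sum>\<^sub>\<infinity>n. q powi tri n)"
text \<open>Twice Jacobi's series for the cube of Euler's product of all \<open>1 - q^n\<close>:
  both factors \<open>alt_sign n\<close> and \<open>2 * n + 1\<close> change sign under
  \<open>n -> -1 - n\<close>.\<close>

definition \<eta> :: "complex \<Rightarrow> complex" where
  "\<eta> q = (\<Sum>\<^sub>\<infinity>n. alt_sign n * of_int (2 * n + 1) * q powi tri n)"

lemma two_tri: "2 * tri n = n * (n + 1)"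
  by (simp add: tri_def)

lemma tri_ge: "tri n \<ge> \<bar>n\<bar> - int 1"
proof -
  have "0 \<le> (\<bar>n\<bar> - 1) * (\<bar>n\<bar> - 2)"
    by (cases "\<bar>n\<bar> \<le> 1"; cases "n = 0") (auto simp: zero_le_mult_iff)
  hence "2 * \<bar>n\<bar> - 2 \<le> \<bar>n\<bar> * \<bar>n\<bar> - \<bar>n\<bar>" by (simp add: algebra_simps)
  also have "\<dots> \<le> n * (n + 1)" by (simp add: algebra_simps)
  finally show ?thesis using two_tri[of n] by simp
qed

lemma tri_nonneg [simp]: "tri n \<ge> 0"
  using two_tri[of n] mult_nonneg_nonneg[of n "n + 1"] mult_nonpos_nonpos[of n "n + 1"] by linarith

lemma square_ge: "(n::int)\<^sup>2 \<ge> \<bar>n\<bar> - int 0"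
  using self_le_power[of "\<bar>n\<bar>" 2] by (cases "n = 0") auto

lemma tri_reflect [simp]: "tri (- 1 - n) = tri n"
  by (simp add: tri_def algebra_simps)

lemma tri_add_even: "tri (k + l) + tri (k - l) = 2 * tri k + l\<^sup>2"
proof -
  have "2 * (tri (k + l) + tri (k - l)) = 2 * (2 * tri k + l\<^sup>2)"
    by (simp only: distrib_left two_tri mult.left_commute[of 2 2]) (simp add: two_tri algebra_simps power2_eq_square)
  thus ?thesis by simp
qed

lemma tri_add_odd: "tri (k + l) + tri (l - k - 1) = 2 * tri k + l\<^sup>2"
  using tri_add_even[of k l] tri_reflect[of "k - l"] by (simp add: algebra_simps)

lemma alt_sign_add: "alt_sign (m + n) = alt_sign m * alt_sign n"
  by (auto simp: alt_sign_def)
lemma alt_sign_minus [simp]: "alt_sign (- n) = alt_sign n"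
  by (auto simp: alt_sign_def)
lemma alt_sign_diff: "alt_sign (m - n) = alt_sign m * alt_sign n"
  by (auto simp: alt_sign_def)
lemma alt_sign_one [simp]: "alt_sign 1 = - 1"
  by (auto simp: alt_sign_def)
lemma norm_alt_sign [simp]: "norm (alt_sign n) = 1"
  by (auto simp: alt_sign_def)

context
  fixes q :: complex
  assumes q: "q \<noteq> 0" "norm q < 1"
begin

lemma summable_\<theta>3: "(\<lambda>n. q powi (n\<^sup>2)) summable_on UNIV"
  using summable_on_int_powi[OF q, where e="\<lambda>n. n\<^sup>2" and B=0 and c="\<lambda>_. 1" and C=1 and i=0] square_ge by simp

lemma summable_\<theta>4: "(\<lambda>n. alt_sign n * q powi (n\<^sup>2)) summable_on UNIV"
  using summable_on_int_powi[OF q, where e="\<lambda>n. n\<^sup>2" and B=0 and c=alt_sign and C=1 and i=0] square_ge by simp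

lemma summable_\<psi>: "(\<lambda>n. q powi tri n) summable_on UNIV"
  using summable_on_int_powi[OF q, where e=tri and B=1 and c="\<lambda>_. 1" and C=1 and i=0] tri_ge by simp

lemma norm_affine_le: "norm (alt_sign n * of_int (2 * n + 1)) \<le> 2 * (\<bar>real_of_int n\<bar> + 1) ^ 1"
  by (simp add: norm_mult del: of_int_add of_int_mult)

lemma summable_\<eta>: "(\<lambda>n. alt_sign n * of_int (2 * n + 1) * q powi tri n) summable_on UNIV"
  by (rule summable_on_int_powi[OF q tri_ge norm_affine_le])

lemma square_in_unit_disc: "q\<^sup>2 \<noteq> 0" "norm (q\<^sup>2) < 1"
  using q by (auto simp: norm_power power_less_one_iff)

end

lemma power_int_square: "((q::complex)\<^sup>2) powi n = q powi (2 * n)"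
  by (simp add: power_int_power)

lemma powi_tri_even:
  assumes "q \<noteq> (0::complex)"
  shows "q powi tri (k + l) * q powi tri (k - l) = (q\<^sup>2) powi tri k * q powi (l\<^sup>2)"
  using assms by (simp only: power_int_square flip: power_int_add) (simp add: tri_add_even flip: power_int_add)

lemma powi_tri_odd:
  assumes "q \<noteq> (0::complex)"
  shows "q powi tri (k + l) * q powi tri (l - k - 1) = (q\<^sup>2) powi tri k * q powi (l\<^sup>2)"
  using assms by (simp only: power_int_square flip: power_int_add) (simp add: tri_add_odd flip: power_int_add)

text \<open>Both parity classes have the exponent \<open>2 * tri k + l^2\<close>, whence the factor
  2.\<close>

lemma \<psi>_square:
  assumes q: "q \<noteq> 0" "norm q < 1"
  shows "\<psi> q ^ 2 = 2 * \<psi> (q\<^sup>2) * \<theta>3 q"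
proof -
  let ?F = "\<lambda>(a, b). q powi tri a * q powi tri b"
  let ?G = "\<lambda>(k, l). (q\<^sup>2) powi tri k * q powi (l\<^sup>2)"
  have sF: "?F summable_on UNIV" and F: "infsum ?F UNIV = \<psi> q * \<psi> q"
    using has_sum_product[OF summable_\<psi>[OF q] summable_\<psi>[OF q]]
    by (simp_all add: \<psi>_def infsumI has_sum_imp_summable)
  have G: "infsum ?G UNIV = \<psi> (q\<^sup>2) * \<theta>3 q"
    using has_sum_product[OF summable_\<psi>[OF square_in_unit_disc[OF q]] summable_\<theta>3[OF q]]
    by (simp_all add: \<psi>_def \<theta>3_def infsumI)
  have 1: "?F (k + l, k - l) = ?G (k, l)" and 2: "?F (k + l, l - k - 1) = ?G (k, l)" for k l
    using q by (simp_all add: powi_tri_even powi_tri_odd)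
  show ?thesis
    using infsum_int_pair_parity_split[OF sF] unfolding F 1 2
    by (simp add: power2_eq_square G[unfolded power2_eq_square])
qed

text \<open>Equal parities give the right-hand side. For opposite parities, exchanging the two
  indices, which is \<open>k -> -1 - k\<close>, keeps the exponent and flips the sign, so that class
  sums to 0.\<close>

lemma \<theta>3_times_\<theta>4:
  assumes q: "q \<noteq> 0" "norm q < 1"
  shows "\<theta>3 q * \<theta>4 q = \<theta>4 (q\<^sup>2) ^ 2"
proof -
  let ?F = "\<lambda>(a, b). q powi a\<^sup>2 * (alt_sign b * q powi b\<^sup>2)"
  let ?G = "\<lambda>(k, l). (alt_sign k * (q\<^sup>2) powi k\<^sup>2) * (alt_sign l * (q\<^sup>2) powi l\<^sup>2)"
  have sF: "?F summable_on UNIV" and F: "infsum ?F UNIV = \<theta>3 q * \<theta>4 q"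
    using has_sum_product[OF summable_\<theta>3[OF q] summable_\<theta>4[OF q]]
    by (simp_all add: \<theta>3_def \<theta>4_def infsumI has_sum_imp_summable)
  have G: "infsum ?G UNIV = \<theta>4 (q\<^sup>2) * \<theta>4 (q\<^sup>2)"
    using has_sum_product[OF summable_\<theta>4[OF square_in_unit_disc[OF q]] summable_\<theta>4[OF square_in_unit_disc[OF q]]]
    by (simp_all add: \<theta>4_def infsumI)
  have 1: "?F (k + l, k - l) = ?G (k, l)" for k l
  proof -
    have "(k + l)\<^sup>2 + (k - l)\<^sup>2 = 2 * k\<^sup>2 + 2 * l\<^sup>2" by (simp add: power2_eq_square algebra_simps)
    thus ?thesis using q
      by (simp add: alt_sign_diff power_int_square mult_ac power_int_add[symmetric])
  qed
  let ?O = "\<lambda>(k, l). ?F (k + l, l - k - 1)"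
  have "infsum ?O UNIV = infsum (\<lambda>x. - ?O x) UNIV"
  proof (rule infsum_reindex_bij_witness[of _ "\<lambda>(k, l). (- 1 - k, l)" "\<lambda>(k, l). (- 1 - k, l)"], goal_cases)
    case (5 x)
    show ?case
      by (cases x) (simp add: alt_sign_def algebra_simps power2_eq_square)
  qed auto
  hence "infsum ?O UNIV = 0" by (simp add: infsum_uminus)
  thus ?thesis
    using infsum_int_pair_parity_split[OF sF] unfolding F 1
    by (simp add: power2_eq_square G[unfolded power2_eq_square])
qed

text \<open>The linear factor splits as \<open>2 * (k + l) + 1 = (2 * k + 1) + 2 * l\<close>. The
  second part is odd in \<open>l\<close> and sums to 0; the first part factors.\<close>

lemma \<eta>_times_\<psi>:
  assumes q: "q \<noteq> 0" "norm q < 1"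
  shows "\<eta> q * \<psi> q = 2 * \<eta> (q\<^sup>2) * \<theta>4 q"
proof -
  let ?F = "\<lambda>(a, b). alt_sign a * of_int (2 * a + 1) * q powi tri a * q powi tri b"
  let ?G = "\<lambda>(k, l). (alt_sign k * of_int (2 * k + 1) * (q\<^sup>2) powi tri k) * (alt_sign l * q powi (l\<^sup>2))"
  let ?H = "\<lambda>(k, l). (alt_sign k * (q\<^sup>2) powi tri k) * (alt_sign l * of_int (2 * l) * q powi (l\<^sup>2))"
  have sF: "?F summable_on UNIV" and F: "infsum ?F UNIV = \<eta> q * \<psi> q"
    using has_sum_product[OF summable_\<eta>[OF q] summable_\<psi>[OF q]]
    by (simp_all add: \<psi>_def \<eta>_def infsumI has_sum_imp_summable)
  have sG: "?G summable_on UNIV" and G: "infsum ?G UNIV = \<eta> (q\<^sup>2) * \<theta>4 q"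
    using has_sum_product[OF summable_\<eta>[OF square_in_unit_disc[OF q]] summable_\<theta>4[OF q]]
    by (simp_all add: \<eta>_def \<theta>4_def infsumI has_sum_imp_summable)
  have FGH: "?F (k + l, k - l) = ?G (k, l) + ?H (k, l)"
    "?F (k + l, l - k - 1) = ?G (k, l) + ?H (k, l)" for k l
    using q by (simp_all add: mult.assoc powi_tri_even powi_tri_odd alt_sign_add) (simp_all add: algebra_simps)
  have "(\<lambda>x. ?G x + ?H x) summable_on UNIV"
    using summable_on_int_pair_even[OF sF] unfolding FGH by (simp add: case_prod_unfold)
  from summable_on_add[OF this sG[THEN summable_on_uminus[THEN iffD2]]] have sH: "?H summable_on UNIV"
    by (simp add: case_prod_unfold)
  have "infsum ?H UNIV = infsum (\<lambda>x. - ?H x) UNIV"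
    by (rule infsum_reindex_bij_witness[of _ "\<lambda>(k, l). (k, - l)" "\<lambda>(k, l). (k, - l)"]) auto
  hence H: "infsum ?H UNIV = 0" by (simp add: infsum_uminus)
  have "(\<Sum>\<^sub>\<infinity>(k, l)\<in>UNIV. ?G (k, l) + ?H (k, l)) = \<eta> (q\<^sup>2) * \<theta>4 q"
    using infsum_add[OF sG sH] unfolding G H by (simp add: case_prod_unfold)
  thus ?thesis
    using infsum_int_pair_parity_split[OF sF] unfolding F FGH by simp
qed

section \<open>Limits at 0 and descent along repeated squaring\<close>

lemma continuous_on_infsum_powi:
  fixes c :: "'a \<Rightarrow> complex" and e :: "'a \<Rightarrow> int"
  assumes e: "\<And>x. x \<in> X \<Longrightarrow> c x \<noteq> 0 \<Longrightarrow> e x \<ge> 0" and r: "r > 0"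
    and summable: "(\<lambda>x. c x * complex_of_real r powi e x) summable_on X"
  shows "continuous_on (cball 0 r) (\<lambda>q. \<Sum>\<^sub>\<infinity>x\<in>X. c x * q powi e x)"
proof (rule uniform_limit_theorem)
  have cp: "c x * q powi e x = c x * q ^ nat (e x)" if "x \<in> X" for x q
    using e[OF that] by (cases "c x = 0") (auto simp: power_int_def)
  show "uniform_limit (cball 0 r) (\<lambda>X q. \<Sum>x\<in>X. c x * q powi e x)
      (\<lambda>q. \<Sum>\<^sub>\<infinity>x\<in>X. c x * q powi e x) (finite_subsets_at_top X)"
  proof (rule Weierstrass_m_test_general)
    show "(\<lambda>x. norm (c x * complex_of_real r powi e x)) summable_on X"
      using summable by (simp add: summable_on_iff_abs_summable_on_complex)
    show "norm (c x * q powi e x) \<le> norm (c x * complex_of_real r powi e x)"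
      if "x \<in> X" "q \<in> cball 0 r" for x q
      using that r by (simp add: cp norm_mult norm_power mult_left_mono power_mono)
  qed
  have "continuous_on (cball 0 r) (\<lambda>q. \<Sum>x\<in>Y. c x * q powi e x)" if "Y \<subseteq> X" for Y
  proof -
    have "continuous_on (cball 0 r) (\<lambda>q. \<Sum>x\<in>Y. c x * q ^ nat (e x))"
      by (intro continuous_intros)
    thus ?thesis using that by (simp add: cp subset_iff cong: sum.cong)
  qed
  thus "\<forall>\<^sub>F Y in finite_subsets_at_top X. continuous_on (cball 0 r) (\<lambda>q. \<Sum>x\<in>Y. c x * q powi e x)"
    by (intro eventually_finite_subsets_at_top_weakI) auto
qed auto

text \<open>Negative exponents are tolerated where \<open>c x\<close> vanishes, as happens in the
  multiple sum. All other terms are ordinary powers, dominated on the closed disc by their size at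
  radius \<open>r\<close>, so the limit is the series evaluated at 0.\<close>

lemma tendsto_infsum_powi:
  fixes c :: "'a \<Rightarrow> complex" and e :: "'a \<Rightarrow> int"
  assumes e: "\<And>x. x \<in> X \<Longrightarrow> c x \<noteq> 0 \<Longrightarrow> e x \<ge> 0" and r: "r > 0"
    and summable: "(\<lambda>x. c x * complex_of_real r powi e x) summable_on X"
  shows "((\<lambda>q. \<Sum>\<^sub>\<infinity>x\<in>X. c x * q powi e x) \<longlongrightarrow> (\<Sum>\<^sub>\<infinity>x\<in>X. c x * 0 powi e x)) (at 0)"
proof -
  have "continuous_on (ball 0 r) (\<lambda>q. \<Sum>\<^sub>\<infinity>x\<in>X. c x * q powi e x)"
    by (rule continuous_on_subset[OF continuous_on_infsum_powi[OF assms]]) auto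
  hence "isCont (\<lambda>q. \<Sum>\<^sub>\<infinity>x\<in>X. c x * q powi e x) 0"
    using r by (simp add: continuous_on_eq_continuous_at)
  thus ?thesis by (simp add: isCont_def)
qed

lemma tendsto_power_two_power:
  fixes q :: complex
  assumes "q \<noteq> 0" "norm q < 1"
  shows "filterlim (\<lambda>n::nat. q ^ (2 ^ n)) (at 0) sequentially"
proof -
  have "(\<lambda>n. q ^ n) \<longlonglongrightarrow> 0" using assms by (simp add: LIMSEQ_power_zero)
  from LIMSEQ_subseq_LIMSEQ[OF this, of "\<lambda>n. 2 ^ n"]
  have "(\<lambda>n. q ^ (2 ^ n)) \<longlonglongrightarrow> 0" by (simp add: strict_mono_def o_def)
  thus ?thesis using assms by (simp add: filterlim_at)
qed

lemma norm_power_two_power: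
  fixes q :: complex
  assumes "q \<noteq> 0" "norm q < 1"
  shows "q ^ (2 ^ n) \<noteq> 0" "norm (q ^ (2 ^ n)) < 1"
  using assms by (simp_all add: norm_power power_less_one_iff)

lemma power_two_power_Suc: "q ^ (2 ^ Suc n) = ((q::complex) ^ (2 ^ n))\<^sup>2"
  by (simp flip: power_mult add: mult.commute)

text \<open>The value at \<open>q\<close> is repeated at \<open>q^2, q^4, ...\<close>, a sequence
  tending to 0.\<close>

lemma eq_limit_if_square_invariant:
  fixes h :: "complex \<Rightarrow> complex"
  assumes q: "q \<noteq> 0" "norm q < 1" and h: "\<And>q. q \<noteq> 0 \<Longrightarrow> norm q < 1 \<Longrightarrow> h (q\<^sup>2) = h q"
    and lim: "(h \<longlongrightarrow> L) (at 0)"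
  shows "h q = L"
proof -
  have "h (q ^ (2 ^ n)) = h q" for n
  proof (induction n)
    case (Suc n)
    thus ?case unfolding power_two_power_Suc using h[OF norm_power_two_power[OF q]] by simp
  qed auto
  moreover have "(\<lambda>n. h (q ^ (2 ^ n))) \<longlonglongrightarrow> L"
    using filterlim_compose[OF lim tendsto_power_two_power[OF q]] .
  ultimately show ?thesis by (simp add: LIMSEQ_const_iff)
qed

text \<open>One zero would produce zeros along a sequence tending to 0, contradicting the nonzero
  limit.\<close>

lemma nonzero_if_zeros_square:
  fixes h :: "complex \<Rightarrow> complex"
  assumes q: "q \<noteq> 0" "norm q < 1"
    and h: "\<And>q. q \<noteq> 0 \<Longrightarrow> norm q < 1 \<Longrightarrow> h q = 0 \<Longrightarrow> h (q\<^sup>2) = 0"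
    and lim: "(h \<longlongrightarrow> L) (at 0)" and L: "L \<noteq> 0"
  shows "h q \<noteq> 0"
proof
  assume 0: "h q = 0"
  have "h (q ^ (2 ^ n)) = 0" for n
  proof (induction n)
    case (Suc n)
    thus ?case unfolding power_two_power_Suc using h[OF norm_power_two_power[OF q]] by simp
  qed (use 0 in auto)
  moreover have "(\<lambda>n. h (q ^ (2 ^ n))) \<longlonglongrightarrow> L"
    using filterlim_compose[OF lim tendsto_power_two_power[OF q]] .
  ultimately show False using L by (simp add: LIMSEQ_const_iff)
qed

lemma half_in_unit_disc: "complex_of_real (1/2) \<noteq> 0" "norm (complex_of_real (1/2)) < 1"
  by (auto simp del: of_real_divide)

lemma \<theta>4_tendsto_1: "(\<theta>4 \<longlongrightarrow> 1) (at 0)"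
proof -
  have "(\<Sum>\<^sub>\<infinity>n. alt_sign n * 0 powi n\<^sup>2) = (\<Sum>\<^sub>\<infinity>n\<in>{0}. alt_sign n * 0 powi n\<^sup>2)"
    by (rule infsum_cong_neutral) (auto simp: power_int_0_left_if)
  thus ?thesis
    using tendsto_infsum_powi[where X=UNIV and r="1/2" and e="\<lambda>n. n\<^sup>2" and c=alt_sign] summable_\<theta>4[OF half_in_unit_disc]
    by (simp add: \<theta>4_def[abs_def] alt_sign_def)
qed

lemma tri_eq_0_iff: "tri n = 0 \<longleftrightarrow> n = 0 \<or> n = - 1"
  using two_tri[of n] by auto

lemma \<psi>_tendsto_2: "(\<psi> \<longlongrightarrow> 2) (at 0)"
proof -
  have "(\<Sum>\<^sub>\<infinity>n. 1 * (0::complex) powi tri n) = (\<Sum>\<^sub>\<infinity>n\<in>{0, -1}. 1 * 0 powi tri n)"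
    by (rule infsum_cong_neutral) (auto simp: power_int_0_left_if tri_eq_0_iff)
  also have "\<dots> = 2" by (simp add: tri_def)
  finally show ?thesis
    using tendsto_infsum_powi[where X=UNIV and r="1/2" and e=tri and c="\<lambda>_. 1"] summable_\<psi>[OF half_in_unit_disc]
    by (simp add: \<psi>_def[abs_def])
qed

lemma \<eta>_tendsto_2: "(\<eta> \<longlongrightarrow> 2) (at 0)"
proof -
  let ?c = "\<lambda>n. alt_sign n * of_int (2 * n + 1)"
  have "(\<Sum>\<^sub>\<infinity>n. ?c n * 0 powi tri n) = (\<Sum>\<^sub>\<infinity>n\<in>{0, -1}. ?c n * 0 powi tri n)"
    by (rule infsum_cong_neutral) (auto simp: power_int_0_left_if tri_eq_0_iff)
  also have "\<dots> = 2" by (simp add: tri_def alt_sign_def)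
  finally show ?thesis
    using tendsto_infsum_powi[where X=UNIV and r="1/2" and e=tri and c="?c"] summable_\<eta>[OF half_in_unit_disc]
    by (simp add: \<eta>_def[abs_def])
qed

lemma \<theta>4_nonzero:
  assumes q: "q \<noteq> 0" "norm q < 1"
  shows "\<theta>4 q \<noteq> 0"
proof (rule nonzero_if_zeros_square[OF q _ \<theta>4_tendsto_1])
  show "\<theta>4 (q\<^sup>2) = 0" if "q \<noteq> 0" "norm q < 1" "\<theta>4 q = 0" for q
    using \<theta>3_times_\<theta>4[of q] that by simp
qed auto

lemma \<theta>3_nonzero:
  assumes q: "q \<noteq> 0" "norm q < 1"
  shows "\<theta>3 q \<noteq> 0"
  using \<theta>3_times_\<theta>4[OF q] \<theta>4_nonzero[OF square_in_unit_disc[OF q]] by auto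

lemma \<psi>_nonzero:
  assumes q: "q \<noteq> 0" "norm q < 1"
  shows "\<psi> q \<noteq> 0"
proof (rule nonzero_if_zeros_square[OF q _ \<psi>_tendsto_2])
  show "\<psi> (q\<^sup>2) = 0" if "q \<noteq> 0" "norm q < 1" "\<psi> q = 0" for q
    using \<psi>_square[of q] \<theta>3_nonzero[of q] that by simp
qed auto

text \<open>By the three product identities the quotient of the two sides is invariant under
  squaring \<open>q\<close>, and it tends to \<open>2 / (2 * 1) = 1\<close> at 0.\<close>

lemma \<eta>_eq:
  assumes q: "q \<noteq> 0" "norm q < 1"
  shows "\<eta> q = \<psi> q * (\<theta>4 q)\<^sup>2"
proof -
  define h where "h = (\<lambda>q. \<eta> q / (\<psi> q * (\<theta>4 q)\<^sup>2))"
  have "h q = 1"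
  proof (rule eq_limit_if_square_invariant[OF q])
    show "(h \<longlongrightarrow> 1) (at 0)"
      unfolding h_def by (rule tendsto_eq_intros \<eta>_tendsto_2 \<psi>_tendsto_2 \<theta>4_tendsto_1 refl | simp)+
    fix q :: complex assume q: "q \<noteq> 0" "norm q < 1"
    have nz: "\<psi> q \<noteq> 0" "\<theta>4 q \<noteq> 0" "\<psi> (q\<^sup>2) \<noteq> 0" "\<theta>4 (q\<^sup>2) \<noteq> 0"
      using \<psi>_nonzero \<theta>4_nonzero square_in_unit_disc[OF q] q by auto
    \<comment> \<open>Cross-multiplied invariance. The extra factor \<open>\<psi> q\<close> creates
      the product \<open>\<eta> q * \<psi> q\<close>, to which the doubling identity
      applies.\<close>
    have "\<eta> q * (\<psi> (q\<^sup>2) * (\<theta>4 (q\<^sup>2))\<^sup>2) * \<psi> q = (\<eta> q * \<psi> q) * \<psi> (q\<^sup>2) * (\<theta>3 q * \<theta>4 q)"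
      by (simp add: \<theta>3_times_\<theta>4[OF q])
    also have "\<dots> = \<eta> (q\<^sup>2) * (\<theta>4 q)\<^sup>2 * (2 * \<psi> (q\<^sup>2) * \<theta>3 q)"
      by (simp add: \<eta>_times_\<psi>[OF q] power2_eq_square)
    also have "\<dots> = \<eta> (q\<^sup>2) * (\<psi> q * (\<theta>4 q)\<^sup>2) * \<psi> q"
      by (simp add: \<psi>_square[OF q, symmetric]) (simp add: power2_eq_square)
    finally have "\<eta> q * (\<psi> (q\<^sup>2) * (\<theta>4 (q\<^sup>2))\<^sup>2) = \<eta> (q\<^sup>2) * (\<psi> q * (\<theta>4 q)\<^sup>2)"
      using nz by simp
    thus "h (q\<^sup>2) = h q" using nz by (simp add: h_def frac_eq_eq)
  qed
  thus ?thesis using \<psi>_nonzero[OF q] \<theta>4_nonzero[OF q] by (simp add: h_def)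
qed

text \<open>With \<open>q = p^2\<close> this turns \<open>\<eta> (p^4)\<close>, the constant
  produced by the moments, into theta constants at \<open>q\<close>.\<close>

lemma \<eta>_square_eq:
  assumes q: "q \<noteq> 0" "norm q < 1"
  shows "2 * \<eta> (q\<^sup>2) = (\<psi> q)\<^sup>2 * \<theta>4 q"
proof -
  have "2 * \<eta> (q\<^sup>2) * \<theta>4 q = ((\<psi> q)\<^sup>2 * \<theta>4 q) * \<theta>4 q"
    using \<eta>_times_\<psi>[OF q] \<eta>_eq[OF q] by (auto simp: power2_eq_square mult_ac)
  thus ?thesis using \<theta>4_nonzero[OF q] by simp
qed

lemma \<psi>_eq_triangle_series:
  assumes q: "q \<noteq> 0" "norm q < 1"
  shows "\<psi> q = 2 * triangle_series q"
proof -
  let ?f = "\<lambda>n. q powi tri n"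
  let ?g = "\<lambda>n. q ^ (n * (n + 1) div 2)"
  have fg: "?f (int n) = ?g n" for n
    unfolding tri_def by (simp add: power_int_def nat_div_distrib nat_mult_distrib nat_add_distrib)
  have 1: "infsum ?f (range int) = infsum ?g UNIV"
    by (subst infsum_reindex) (auto simp: o_def fg)
  have 2: "infsum ?f (range (\<lambda>n. - 1 - int n)) = infsum ?g UNIV"
    by (subst infsum_reindex) (auto simp: o_def fg inj_on_def)
  have "?g summable_on UNIV"
    using summable_on_subset[OF summable_\<psi>[OF q], of "range int"] summable_on_reindex[of int UNIV ?f]
    by (simp add: o_def fg)
  hence 3: "infsum ?g UNIV = triangle_series q"
    unfolding triangle_series_def by (simp add: has_sum_imp_sums sums_unique)
  have "UNIV = range int \<union> range (\<lambda>n. - 1 - int n)"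
  proof (intro equalityI subsetI)
    fix x :: int
    show "x \<in> range int \<union> range (\<lambda>n. - 1 - int n)"
    proof (cases "x \<ge> 0")
      case True
      thus ?thesis by (auto intro!: rangeI image_eqI[of x int "nat x"])
    next
      case False
      thus ?thesis by (auto intro!: image_eqI[of x "\<lambda>n. - 1 - int n" "nat (- 1 - x)"])
    qed
  qed auto
  hence "\<psi> q = infsum ?f (range int \<union> range (\<lambda>n. - 1 - int n))"
    by (simp add: \<psi>_def)
  also have "\<dots> = infsum ?f (range int) + infsum ?f (range (\<lambda>n. - 1 - int n))"
    by (intro infsum_Un_disjoint summable_on_subset[OF summable_\<psi>[OF q]]) auto
  finally show ?thesis using 1 2 3 by simp
qed

subsection \<open>Moments and the Kronecker-type identity\<close>

lemma summable_on_pair_dominated: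
  fixes F :: "'a \<times> 'b \<Rightarrow> complex" and f :: "'a \<Rightarrow> real" and g :: "'b \<Rightarrow> real"
  assumes f: "f summable_on A" and g: "g summable_on B"
    and le: "\<And>x y. x \<in> A \<Longrightarrow> y \<in> B \<Longrightarrow> norm (F (x, y)) \<le> f x * g y"
  shows "F summable_on A \<times> B"
proof (rule abs_summable_summable[OF Infinite_Sum.abs_summable_on_comparison_test'])
  have "(\<lambda>x. complex_of_real (f x)) summable_on A" "(\<lambda>x. complex_of_real (g x)) summable_on B"
    using f g by (auto intro: summable_on_of_real)
  from summable_on_product[OF this]
  show "(\<lambda>z. norm (case z of (x, y) \<Rightarrow> complex_of_real (f x) * complex_of_real (g y))) summable_on A \<times> B"
    by (simp add: summable_on_iff_abs_summable_on_complex)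
  fix z assume "z \<in> A \<times> B"
  thus "norm (F z) \<le> norm (case z of (x, y) \<Rightarrow> complex_of_real (f x) * complex_of_real (g y))"
    by (cases z) (use le in \<open>force simp flip: of_real_mult\<close>)
qed

lemma summable_on_int_pair:
  fixes F :: "int \<times> int \<Rightarrow> complex" and x :: real
  assumes x: "0 \<le> x" "x < 1"
    and le: "\<And>a b. norm (F (a, b)) \<le>
      ((\<bar>real_of_int a\<bar> + 1) ^ i * x ^ nat \<bar>a\<bar>) * ((\<bar>real_of_int b\<bar> + 1) ^ j * x ^ nat \<bar>b\<bar>)"
  shows "F summable_on UNIV"
  using summable_on_pair_dominated[OF summable_on_int_power_times_geometric[OF x]
      summable_on_int_power_times_geometric[OF x], of F i j] le by simp

lemma has_sum_finite_sum:
  fixes f :: "'i \<Rightarrow> 'a \<Rightarrow> complex"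
  assumes "finite I" "\<And>i. i \<in> I \<Longrightarrow> (f i has_sum s i) A"
  shows "((\<lambda>x. \<Sum>i\<in>I. f i x) has_sum (\<Sum>i\<in>I. s i)) A"
  using assms by (induction I rule: finite_induct) (auto intro!: has_sum_add)

text \<open>The weight on the cone \<open>|r| < s\<close>, extended oddly in \<open>s\<close>, so
  that shifts by arbitrary integers stay inside one array. Against odd powers of \<open>s\<close>
  both halves contribute equally; this is the source of the later division by 2.\<close>

definition kron :: "complex \<Rightarrow> int \<Rightarrow> int \<Rightarrow> complex" where
  "kron p s r = (if \<bar>r\<bar> < \<bar>s\<bar> \<and> odd (s + r) then of_int (sgn s) * p powi (s\<^sup>2 - r\<^sup>2) else 0)"

definition even_gauss :: "complex \<Rightarrow> int \<Rightarrow> complex" where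
  "even_gauss p n = (if even n then p powi n\<^sup>2 else 0)"

definition odd_gauss :: "complex \<Rightarrow> int \<Rightarrow> complex" where
  "odd_gauss p n = (if odd n then p powi n\<^sup>2 else 0)"

text \<open>This is \<open>i! j!\<close> times the coefficient of \<open>x^i y^j\<close> in the sum
  of \<open>kron p s r * exp (s x + r y)\<close>; likewise for the other moments.\<close>

definition kron_moment :: "complex \<Rightarrow> nat \<Rightarrow> nat \<Rightarrow> complex" where
  "kron_moment p i j = (\<Sum>\<^sub>\<infinity>(s, r). kron p s r * of_int s ^ i * of_int r ^ j)"

definition even_moment :: "complex \<Rightarrow> nat \<Rightarrow> complex" where
  "even_moment p i = (\<Sum>\<^sub>\<infinity>n. even_gauss p n * of_int n ^ i)"

definition odd_moment :: "complex \<Rightarrow> nat \<Rightarrow> complex" where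
  "odd_moment p i = (\<Sum>\<^sub>\<infinity>n. odd_gauss p n * of_int n ^ i)"

definition theta_kernel :: "complex \<Rightarrow> int \<Rightarrow> int \<Rightarrow> complex" where
  "theta_kernel p m n = even_gauss p m * even_gauss p n - odd_gauss p m * odd_gauss p n"

definition theta_moment :: "complex \<Rightarrow> nat \<Rightarrow> nat \<Rightarrow> complex" where
  "theta_moment p i j = even_moment p i * even_moment p j - odd_moment p i * odd_moment p j"

text \<open>The symmetric quantum integer: for positive \<open>D\<close> it is
  \<open>(x^D - x^(-D)) / (x - 1/x)\<close>, written as a finite sum so that it also makes sense at
  \<open>x = 1\<close>.\<close>

definition parity_geo :: "complex \<Rightarrow> int \<Rightarrow> complex" where
  "parity_geo x D = (\<Sum>d | \<bar>d\<bar> < \<bar>D\<bar> \<and> odd (d + D). x powi d)"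

lemma parity_geo_Suc_Suc:
  "parity_geo x (int (Suc (Suc n))) = x powi (int n + 1) + x powi (- (int n + 1)) + parity_geo x (int n)"
proof -
  have fin: "finite {d. \<bar>d\<bar> < \<bar>int n\<bar> \<and> odd (d + int n)}"
    by (rule finite_subset[of _ "{- int n..int n}"]) auto
  have "{d. \<bar>d\<bar> < \<bar>int (Suc (Suc n))\<bar> \<and> odd (d + int (Suc (Suc n)))} =
      insert (int n + 1) (insert (- (int n + 1)) {d. \<bar>d\<bar> < \<bar>int n\<bar> \<and> odd (d + int n)})"
    by (auto simp: abs_if) presburger+
  thus ?thesis unfolding parity_geo_def using fin by (simp add: add.assoc del: of_nat_Suc)
qed

lemma parity_geo_0: "parity_geo x 0 = 0"
  by (simp add: parity_geo_def)

lemma parity_geo_1: "parity_geo x 1 = 1"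
proof -
  have "{d::int. \<bar>d\<bar> < \<bar>1\<bar> \<and> odd (d + 1)} = {0}" by auto
  thus ?thesis unfolding parity_geo_def by simp
qed

lemma parity_geo_minus: "parity_geo x (- D) = parity_geo x D"
  unfolding parity_geo_def by (rule sum.cong) auto

lemma parity_geo_nat:
  assumes x: "x \<noteq> 0"
  shows "(x - inverse x) * parity_geo x (int n) = x powi int n - x powi (- int n)"
proof (induction n rule: induct_nat_012)
  case (ge2 n)
  have "(x - inverse x) * (x powi (int n + 1) + x powi (- (int n + 1))) =
        (x powi (int n + 2) - x powi (- (int n + 2))) - (x powi int n - x powi (- int n))"
    using x by (simp add: power_int_add power_int_diff power_int_minus field_simps power2_eq_square)
  moreover have "int (Suc (Suc n)) = int n + 2" by simp
  ultimately show ?case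
    unfolding parity_geo_Suc_Suc distrib_left[of _ _ "parity_geo x (int n)"] ge2(1) by (simp add: algebra_simps)
qed (auto simp: parity_geo_0 parity_geo_1 power_int_minus)

lemma parity_geo_mult:
  assumes x: "x \<noteq> 0"
  shows "(x - inverse x) * (of_int (sgn D) * parity_geo x D) = x powi D - x powi (- D)"
proof (cases D rule: int_cases2)
  case (nonneg n)
  thus ?thesis using parity_geo_nat[OF x, of n] by (cases "n = 0") auto
next
  case (nonpos n)
  thus ?thesis using parity_geo_nat[OF x, of n] by (cases "n = 0") (auto simp: parity_geo_minus algebra_simps)
qed

text \<open>At \<open>x = 1\<close> the closed form degenerates to 0/0, so the terms are counted.
  This is the case of the axis \<open>R = 0\<close> below.\<close>

lemma parity_geo_one: "of_int (sgn D) * parity_geo 1 D = of_int D"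
proof -
  have *: "parity_geo 1 (int n) = of_nat n" for n
    by (induction n rule: induct_nat_012) (auto simp: parity_geo_Suc_Suc parity_geo_0 parity_geo_1 simp del: of_nat_Suc, auto simp: parity_geo_1)
  show ?thesis
    by (cases D rule: int_cases2) (auto simp: * parity_geo_minus sgn_if)
qed

lemma theta_kernel_eq:
  assumes "p \<noteq> 0"
  shows "theta_kernel p m n = (if even (m + n) then alt_sign m * p powi (m\<^sup>2 + n\<^sup>2) else 0)"
  using assms by (auto simp: theta_kernel_def even_gauss_def odd_gauss_def alt_sign_def power_int_add)

text \<open>The reflection \<open>n -> d - n\<close> fixes the exponent and, \<open>d\<close> being
  odd, flips the sign.\<close>

lemma alt_quadratic_sum_zero:
  fixes p :: complex
  assumes "odd d"
  shows "(\<Sum>\<^sub>\<infinity>n. alt_sign n * p powi (2 * n\<^sup>2 - 2 * d * n)) = 0"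
proof -
  let ?f = "\<lambda>n. alt_sign n * p powi (2 * n\<^sup>2 - 2 * d * n)"
  have "infsum ?f UNIV = infsum (\<lambda>n. - ?f n) UNIV"
  proof (rule infsum_reindex_bij_witness[of _ "\<lambda>n. d - n" "\<lambda>n. d - n"], goal_cases)
    case (5 n)
    have "2 * (d - n)\<^sup>2 - 2 * d * (d - n) = 2 * n\<^sup>2 - 2 * d * n"
      by (simp add: power2_eq_square algebra_simps)
    thus ?case using assms by (simp add: alt_sign_def)
  qed auto
  thus ?thesis by (simp add: infsum_uminus)
qed

section \<open>Convolution of the cone weight with the theta kernel\<close>

context
  fixes p :: complex
  assumes p: "p \<noteq> 0" "norm p < 1"
begin

lemma summable_alt_quadratic: "(\<lambda>n. alt_sign n * p powi (2 * n\<^sup>2 - 2 * d * n)) summable_on UNIV"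
proof (rule summable_on_int_powi[OF p, where B = "nat (d\<^sup>2)" and C = 1 and i = 0])
  fix n :: int
  \<comment> \<open>The exponent is \<open>n^2 + (n - d)^2 - d^2\<close>, which explains the slack
    \<open>d^2\<close>.\<close>
  have "0 \<le> (n - d)\<^sup>2" by simp
  thus "2 * n\<^sup>2 - 2 * d * n \<ge> \<bar>n\<bar> - int (nat (d\<^sup>2))"
    using square_ge[of n] by (simp add: power2_eq_square algebra_simps)
qed auto

text \<open>On the cone the indefinite form is still large:
  \<open>s^2 - r^2 >= 2 * |s| - 1 >= |s|\<close>. Since \<open>2 * |s| >= |s| + |r|\<close>, the
  decay splits between the two variables with ratio \<open>sqrt (norm p)\<close>.\<close>

lemma summable_kron: "(\<lambda>(s, r). kron p s r * of_int s ^ i * of_int r ^ j) summable_on UNIV"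
proof (rule summable_on_int_pair[where x = "sqrt (norm p)" and i = i and j = j])
  show "sqrt (norm p) < 1" using p by simp
  fix s r :: int
  let ?x = "sqrt (norm p)"
  have k: "norm (kron p s r) \<le> ?x ^ nat \<bar>s\<bar> * ?x ^ nat \<bar>r\<bar>"
  proof (cases "\<bar>r\<bar> < \<bar>s\<bar> \<and> odd (s + r)")
    case True
    have "r\<^sup>2 \<le> (\<bar>s\<bar> - 1)\<^sup>2"
      using True by (subst abs_le_square_iff[symmetric]) auto
    moreover have "1 \<le> \<bar>s\<bar>" using True by linarith
    ultimately have "\<bar>s\<bar> \<le> s\<^sup>2 - r\<^sup>2"
      by (simp add: power2_eq_square algebra_simps)
    hence "norm p powi (s\<^sup>2 - r\<^sup>2) \<le> norm p powi \<bar>s\<bar>"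
      using p by (intro power_int_decreasing) auto
    also have "\<dots> = (?x\<^sup>2) ^ nat \<bar>s\<bar>" by (simp add: power_int_def)
    also have "\<dots> = ?x ^ (nat \<bar>s\<bar> + nat \<bar>s\<bar>)" by (simp only: power_mult[symmetric] mult_2)
    also have "\<dots> \<le> ?x ^ (nat \<bar>s\<bar> + nat \<bar>r\<bar>)"
      using True p by (intro power_decreasing) auto
    finally show ?thesis using True
      by (auto simp: kron_def norm_mult norm_power_int power_add sgn_if)
  qed (auto simp: kron_def)
  have "norm (kron p s r) * (\<bar>of_int s\<bar> ^ i * \<bar>of_int r\<bar> ^ j) \<le>
     (?x ^ nat \<bar>s\<bar> * ?x ^ nat \<bar>r\<bar>) * ((\<bar>real_of_int s\<bar> + 1) ^ i * (\<bar>real_of_int r\<bar> + 1) ^ j)"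
    by (intro mult_mono k power_mono) auto
  thus "norm (case (s, r) of (s, r) \<Rightarrow> kron p s r * of_int s ^ i * of_int r ^ j) \<le>
      ((\<bar>real_of_int s\<bar> + 1) ^ i * ?x ^ nat \<bar>s\<bar>) * ((\<bar>real_of_int r\<bar> + 1) ^ j * ?x ^ nat \<bar>r\<bar>)"
    by (simp add: norm_mult norm_power mult_ac)
qed auto

lemma summable_gauss_power:
  assumes "\<And>n. norm (c n) \<le> 1"
  shows "(\<lambda>n. (c n * of_int n ^ i) * p powi n\<^sup>2) summable_on UNIV"
proof (rule summable_on_int_powi[OF p square_ge, where C = 1 and i = i])
  show "norm (c n * of_int n ^ i) \<le> 1 * (\<bar>real_of_int n\<bar> + 1) ^ i" for n
    unfolding norm_mult by (intro mult_mono assms) (auto simp: norm_power intro!: power_mono)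
qed

lemma summable_even_gauss: "(\<lambda>n. even_gauss p n * of_int n ^ i) summable_on UNIV"
  using summable_gauss_power[of "\<lambda>n. if even n then 1 else 0" i]
  by (rule summable_on_cong[THEN iffD1, rotated]) (auto simp: even_gauss_def)

lemma summable_odd_gauss: "(\<lambda>n. odd_gauss p n * of_int n ^ i) summable_on UNIV"
  using summable_gauss_power[of "\<lambda>n. if odd n then 1 else 0" i]
  by (rule summable_on_cong[THEN iffD1, rotated]) (auto simp: odd_gauss_def)

lemma has_sum_theta_kernel:
  "((\<lambda>(m, n). theta_kernel p m n * of_int m ^ i * of_int n ^ j) has_sum theta_moment p i j) UNIV"
proof -
  have "((\<lambda>x. (case x of (m, n) \<Rightarrow> (even_gauss p m * of_int m ^ i) * (even_gauss p n * of_int n ^ j))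
        + - (case x of (m, n) \<Rightarrow> (odd_gauss p m * of_int m ^ i) * (odd_gauss p n * of_int n ^ j)))
      has_sum (even_moment p i * even_moment p j + - (odd_moment p i * odd_moment p j))) (UNIV \<times> UNIV)"
    unfolding even_moment_def odd_moment_def
    by (intro has_sum_add has_sum_uminusI has_sum_product summable_even_gauss summable_odd_gauss)
  thus ?thesis
    by (simp add: theta_moment_def theta_kernel_def case_prod_unfold algebra_simps)
qed

lemma has_sum_kron:
  "((\<lambda>(s, r). kron p s r * of_int s ^ i * of_int r ^ j) has_sum kron_moment p i j) UNIV"
  unfolding kron_moment_def by (rule has_sum_infsum[OF summable_kron])

text \<open>Expanding both powers binomially gives the coefficient rule for a product of exponential
  generating functions.\<close>

lemma has_sum_convolution:
  "((\<lambda>((s, r), (m, n)). kron p s r * theta_kernel p m n * of_int (s + m) ^ i * of_int (r + n) ^ j)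
     has_sum (\<Sum>a\<le>i. \<Sum>b\<le>j. of_nat (i choose a) * of_nat (j choose b) *
        kron_moment p a b * theta_moment p (i - a) (j - b))) UNIV"
proof -
  have 1: "((\<lambda>x. of_nat (i choose a) * of_nat (j choose b) *
        (case x of (y, z) \<Rightarrow> (case y of (s, r) \<Rightarrow> kron p s r * of_int s ^ a * of_int r ^ b) *
           (case z of (m, n) \<Rightarrow> theta_kernel p m n * of_int m ^ (i - a) * of_int n ^ (j - b))))
      has_sum (of_nat (i choose a) * of_nat (j choose b) * (kron_moment p a b * theta_moment p (i - a) (j - b))))
      (UNIV \<times> UNIV)" for a b
    using has_sum_product[OF summable_kron has_sum_theta_kernel[THEN has_sum_imp_summable], of a b "i - a" "j - b"]
    unfolding has_sum_theta_kernel[THEN infsumI] has_sum_kron[THEN infsumI]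
    by (rule has_sum_cmult_right)
  have "((\<lambda>x. \<Sum>a\<le>i. \<Sum>b\<le>j. of_nat (i choose a) * of_nat (j choose b) *
        (case x of (y, z) \<Rightarrow> (case y of (s, r) \<Rightarrow> kron p s r * of_int s ^ a * of_int r ^ b) *
           (case z of (m, n) \<Rightarrow> theta_kernel p m n * of_int m ^ (i - a) * of_int n ^ (j - b))))
      has_sum (\<Sum>a\<le>i. \<Sum>b\<le>j. of_nat (i choose a) * of_nat (j choose b) * (kron_moment p a b * theta_moment p (i - a) (j - b))))
      (UNIV \<times> UNIV)"
    by (intro has_sum_finite_sum 1) auto
  also have "(\<lambda>x. \<Sum>a\<le>i. \<Sum>b\<le>j. of_nat (i choose a) * of_nat (j choose b) *
        (case x of (y, z) \<Rightarrow> (case y of (s, r) \<Rightarrow> kron p s r * of_int s ^ a * of_int r ^ b) *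
           (case z of (m, n) \<Rightarrow> theta_kernel p m n * of_int m ^ (i - a) * of_int n ^ (j - b))))
     = (\<lambda>((s, r), (m, n)). kron p s r * theta_kernel p m n * of_int (s + m) ^ i * of_int (r + n) ^ j)"
    by (rule ext) (auto simp: binomial_ring sum_distrib_left sum_distrib_right mult_ac intro!: sum.cong)
  finally show ?thesis by (simp add: mult_ac)
qed

text \<open>The coefficient of \<open>exp (S x + R y)\<close> in that product.\<close>

definition conv_coeff :: "int \<Rightarrow> int \<Rightarrow> complex" where
  "conv_coeff S R = (\<Sum>\<^sub>\<infinity>(m, n). kron p (S - m) (R - n) * theta_kernel p m n)"

lemma has_sum_convolution_shift:
  "((\<lambda>((S, R), (m, n)). kron p (S - m) (R - n) * theta_kernel p m n * of_int S ^ i * of_int R ^ j)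
     has_sum (\<Sum>a\<le>i. \<Sum>b\<le>j. of_nat (i choose a) * of_nat (j choose b) *
        kron_moment p a b * theta_moment p (i - a) (j - b))) (UNIV \<times> UNIV)"
  (is "(?h has_sum ?s) _")
proof -
  have "((\<lambda>((s, r), (m, n)). kron p s r * theta_kernel p m n * of_int (s + m) ^ i * of_int (r + n) ^ j)
      has_sum ?s) UNIV \<longleftrightarrow> (?h has_sum ?s) (UNIV \<times> UNIV)"
    by (rule has_sum_reindex_bij_witness[of _ "\<lambda>((S, R), (m, n)). ((S - m, R - n), (m, n))"
          "\<lambda>((s, r), (m, n)). ((s + m, r + n), (m, n))"]) auto
  thus ?thesis using has_sum_convolution[of i j] by blast
qed

lemma summable_conv_coeff:
  "(\<lambda>(m, n). kron p (S - m) (R - n) * theta_kernel p m n) summable_on UNIV"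
proof -
  have "(\<lambda>(x, y). case (x, y) of ((S, R), (m, n)) \<Rightarrow> kron p (S - m) (R - n) * theta_kernel p m n)
     summable_on UNIV \<times> UNIV"
    using has_sum_convolution_shift[of 0 0, THEN has_sum_imp_summable] by (simp add: case_prod_unfold)
  from summable_on_SigmaD1[OF this, of "(S, R)"] show ?thesis by (simp add: case_prod_unfold)
qed

lemma has_sum_conv_coeff:
  "((\<lambda>(S, R). conv_coeff S R * of_int S ^ i * of_int R ^ j) has_sum (\<Sum>a\<le>i. \<Sum>b\<le>j. of_nat (i choose a) * of_nat (j choose b) *
        kron_moment p a b * theta_moment p (i - a) (j - b))) UNIV"
proof (rule has_sum_Sigma'[where B = "\<lambda>_. UNIV", OF has_sum_convolution_shift], goal_cases)
  case (1 x)
  obtain S R where x: "x = (S, R)" by (cases x)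
  have "((\<lambda>(m, n). kron p (S - m) (R - n) * theta_kernel p m n) has_sum conv_coeff S R) UNIV"
    unfolding conv_coeff_def by (rule has_sum_infsum[OF summable_conv_coeff])
  from has_sum_cmult_left[OF this, of "of_int S ^ i * of_int R ^ j"]
  show ?case
    by (simp add: x case_prod_unfold mult_ac)
qed

lemma conv_coeff_even: "even (S + R) \<Longrightarrow> conv_coeff S R = 0"
  unfolding conv_coeff_def
  by (rule infsum_0) (auto simp: kron_def theta_kernel_eq[OF p(1)])

text \<open>With \<open>d = R - n\<close>, the exponent
  \<open>(S - m)^2 - d^2 + m^2 + (R - d)^2\<close> loses its \<open>d^2\<close> terms. What remains
  is linear in \<open>d\<close>, and the cone condition makes the sum finite: a geometric sum of
  ratio \<open>p powi (- 2 * R)\<close>.\<close>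

lemma conv_inner_sum:
  assumes "odd (S + R)"
  shows "(\<Sum>\<^sub>\<infinity>n. kron p (S - m) (R - n) * theta_kernel p m n) =
     alt_sign m * p powi (2 * m\<^sup>2 - 2 * S * m + S\<^sup>2 + R\<^sup>2) *
      (of_int (sgn (S - m)) * parity_geo (p powi (- 2 * R)) (S - m))"
proof -
  let ?X = "{d. \<bar>d\<bar> < \<bar>S - m\<bar> \<and> odd (d + (S - m))}"
  let ?K = "alt_sign m * of_int (sgn (S - m)) * p powi (2 * m\<^sup>2 - 2 * S * m + S\<^sup>2 + R\<^sup>2)"
  have fin: "finite ?X" by (rule finite_subset[of _ "{- \<bar>S - m\<bar>..\<bar>S - m\<bar>}"]) auto
  have "(\<Sum>\<^sub>\<infinity>n. kron p (S - m) (R - n) * theta_kernel p m n) =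
      (\<Sum>\<^sub>\<infinity>d. if d \<in> ?X then ?K * (p powi (- 2 * R)) powi d else 0)"
  proof (rule infsum_reindex_bij_witness[of _ "\<lambda>d. R - d" "\<lambda>n. R - n"], goal_cases)
    case (5 n)
    have par: "even (m + n) \<longleftrightarrow> odd ((R - n) + (S - m))" using assms by presburger
    have e: "p powi ((S - m)\<^sup>2 - (R - n)\<^sup>2) * p powi (m\<^sup>2 + n\<^sup>2) =
      p powi (2 * m\<^sup>2 - 2 * S * m + S\<^sup>2 + R\<^sup>2) * (p powi (- 2 * R)) powi (R - n)"
      using p(1) unfolding power_int_mult[symmetric]
      by (subst (1 2) power_int_add[symmetric]) (auto simp: power2_eq_square algebra_simps)
    show ?case
    proof (cases "R - n \<in> ?X")
      case True
      hence "odd ((S - m) + (R - n))" "even (m + n)" using par by (auto simp: add.commute)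
      with True show ?thesis using e by (simp add: kron_def theta_kernel_eq[OF p(1)] mult_ac)
    next
      case False
      thus ?thesis using par by (auto simp: kron_def theta_kernel_eq[OF p(1)] add.commute)
    qed
  qed auto
  also have "\<dots> = (\<Sum>\<^sub>\<infinity>d\<in>?X. ?K * (p powi (- 2 * R)) powi d)"
    by (rule infsum_cong_neutral) auto
  also have "\<dots> = ?K * parity_geo (p powi (- 2 * R)) (S - m)"
    using fin by (simp add: parity_geo_def sum_distrib_left)
  finally show ?thesis by (simp add: mult_ac)
qed

lemma has_sum_conv_coeff_geo:
  assumes "odd (S + R)"
  shows "((\<lambda>m. alt_sign m * p powi (2 * m\<^sup>2 - 2 * S * m + S\<^sup>2 + R\<^sup>2) *
      (of_int (sgn (S - m)) * parity_geo (p powi (- 2 * R)) (S - m))) has_sum conv_coeff S R) UNIV"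
proof -
  have s: "(\<lambda>(m, n). kron p (S - m) (R - n) * theta_kernel p m n) summable_on UNIV \<times> UNIV"
    using summable_conv_coeff by simp
  show ?thesis
    unfolding has_sum_iff conv_inner_sum[OF assms, symmetric]
    using summable_on_Sigma_banach[OF s] infsum_Sigma'_banach[OF s] by (simp add: conv_coeff_def)
qed

text \<open>After multiplication by \<open>x - 1/x\<close> with \<open>x = p\<^sup>-\<^sup>2\<^sup>R\<close> the inner geometric sum telescopes into two
  alternating theta series, each of which is antisymmetric under \<open>m \<mapsto> S \<plusminus> R - m\<close>.\<close>
lemma conv_coeff_zero:
  assumes "odd (S + R)" "R \<noteq> 0"
  shows "conv_coeff S R = 0"
proof -
  let ?x = "p powi (- 2 * R)"
  let ?v = "\<lambda>d n. alt_sign n * p powi (2 * n\<^sup>2 - 2 * d * n)"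
  have x0: "?x \<noteq> 0" using p by simp
  \<comment> \<open>The multiplier must be cancelled at the end. Equality would give
    \<open>norm p powi (- 4 * R) = 1\<close>, impossible for \<open>0 < norm p < 1\<close> and
    \<open>R\<close> nonzero.\<close>
  have "?x \<noteq> inverse ?x"
  proof
    assume "?x = inverse ?x"
    hence "?x * ?x = 1" using x0 by (simp add: field_simps)
    hence "norm ?x * norm ?x = 1" by (metis norm_mult norm_one)
    hence "norm p powi (- 4 * R) = 1"
      using p by (simp add: norm_power_int flip: power_int_add)
    hence "norm p ^ nat \<bar>4 * R\<bar> = 1"
      using p by (auto simp: power_int_def abs_if power_inverse split: if_splits)
    moreover have "norm p ^ nat \<bar>4 * R\<bar> < 1"
      using p assms(2) by (intro power_Suc_less_one power_strict_decreasing[of 0, simplified]) auto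
    ultimately show False by simp
  qed
  have s: "((\<lambda>m. (?x - inverse ?x) * (alt_sign m * p powi (2 * m\<^sup>2 - 2 * S * m + S\<^sup>2 + R\<^sup>2) *
      (of_int (sgn (S - m)) * parity_geo ?x (S - m)))) has_sum (?x - inverse ?x) * conv_coeff S R) UNIV"
    by (intro has_sum_cmult_right has_sum_conv_coeff_geo assms)
  have v: "(?v d has_sum 0) UNIV" if "odd d" for d
    using summable_alt_quadratic[of d] alt_quadratic_sum_zero[OF that, of p] by (simp add: has_sum_iff)
  have "((\<lambda>m. p powi (S - R)\<^sup>2 * ?v (S - R) m + - (p powi (S + R)\<^sup>2 * ?v (S + R) m)) has_sum
      (p powi (S - R)\<^sup>2 * 0 + - (p powi (S + R)\<^sup>2 * 0))) UNIV"
    using assms by (intro has_sum_add has_sum_uminusI has_sum_cmult_right v) auto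
  moreover have "(?x - inverse ?x) * (alt_sign m * p powi (2 * m\<^sup>2 - 2 * S * m + S\<^sup>2 + R\<^sup>2) *
      (of_int (sgn (S - m)) * parity_geo ?x (S - m))) =
     p powi (S - R)\<^sup>2 * ?v (S - R) m + - (p powi (S + R)\<^sup>2 * ?v (S + R) m)" for m
  proof -
    have "(?x - inverse ?x) * (alt_sign m * p powi (2 * m\<^sup>2 - 2 * S * m + S\<^sup>2 + R\<^sup>2) *
      (of_int (sgn (S - m)) * parity_geo ?x (S - m))) = alt_sign m * p powi (2 * m\<^sup>2 - 2 * S * m + S\<^sup>2 + R\<^sup>2) *
        (?x powi (S - m) - ?x powi (- (S - m)))"
      unfolding parity_geo_mult[OF x0, symmetric] by (simp only: mult_ac)
    also have "p powi (2 * m\<^sup>2 - 2 * S * m + S\<^sup>2 + R\<^sup>2) * ?x powi (S - m) =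
        p powi (S - R)\<^sup>2 * p powi (2 * m\<^sup>2 - 2 * (S - R) * m)"
      using p(1) unfolding power_int_mult[symmetric]
      by (subst (1 2) power_int_add[symmetric]) (auto simp: power2_eq_square algebra_simps)
    hence "alt_sign m * p powi (2 * m\<^sup>2 - 2 * S * m + S\<^sup>2 + R\<^sup>2) * (?x powi (S - m) - ?x powi (- (S - m)))
       = alt_sign m * (p powi (S - R)\<^sup>2 * p powi (2 * m\<^sup>2 - 2 * (S - R) * m))
        - alt_sign m * (p powi (2 * m\<^sup>2 - 2 * S * m + S\<^sup>2 + R\<^sup>2) * ?x powi (- (S - m)))"
      by (simp add: algebra_simps)
    also have "p powi (2 * m\<^sup>2 - 2 * S * m + S\<^sup>2 + R\<^sup>2) * ?x powi (- (S - m)) =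
        p powi (S + R)\<^sup>2 * p powi (2 * m\<^sup>2 - 2 * (S + R) * m)"
      using p(1) unfolding power_int_mult[symmetric]
      by (subst (1 2) power_int_add[symmetric]) (auto simp: power2_eq_square algebra_simps)
    finally show ?thesis by (simp add: mult_ac)
  qed
  ultimately have "(?x - inverse ?x) * conv_coeff S R = 0"
    using s has_sum_unique by fastforce
  with \<open>?x \<noteq> inverse ?x\<close> show ?thesis by simp
qed

lemma fourth_power_in_unit_disc: "p ^ 4 \<noteq> 0" "norm (p ^ 4) < 1"
  using p by (auto simp: norm_power power_less_one_iff)

text \<open>For \<open>R = 0\<close> the geometric sum is \<open>S - m\<close>. After
  \<open>m = n + u + 1\<close> it equals \<open>u - n = (u + 1/2) - (2 * n + 1) / 2\<close>. The
  part constant in \<open>n\<close> dies under \<open>n -> -1 - n\<close>, and the other part gives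
  \<open>\<eta>\<close>; the remaining minus sign is that of
  \<open>alt_sign (n + u + 1)\<close>.\<close>

lemma conv_coeff_axis:
  "conv_coeff (2 * u + 1) 0 = \<eta> (p ^ 4) / 2 * (alt_sign u * p * (p ^ 4) powi tri u)"
proof -
  let ?q = "p ^ 4"
  let ?K = "alt_sign u * p * ?q powi tri u"
  let ?f = "\<lambda>n. alt_sign n * ?q powi tri n"
  have s0: "?f summable_on UNIV"
    using summable_on_int_powi[OF fourth_power_in_unit_disc tri_ge, where c=alt_sign and C=1 and i=0] by simp
  have "infsum ?f UNIV = infsum (\<lambda>n. - ?f n) UNIV"
    by (rule infsum_reindex_bij_witness[of _ "\<lambda>n. - 1 - n" "\<lambda>n. - 1 - n"]) (auto simp: alt_sign_def)
  hence f0: "(?f has_sum 0) UNIV" using s0 by (simp add: infsum_uminus has_sum_iff)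
  have eta: "((\<lambda>n. alt_sign n * of_int (2 * n + 1) * ?q powi tri n) has_sum \<eta> ?q) UNIV"
    unfolding \<eta>_def by (rule has_sum_infsum[OF summable_\<eta>[OF fourth_power_in_unit_disc]])
  have "((\<lambda>n. ?K * (1 / 2) * (alt_sign n * of_int (2 * n + 1) * ?q powi tri n) +
       (- ?K * (of_int u + 1/2)) * ?f n) has_sum (?K * (1 / 2) * \<eta> ?q + (- ?K * (of_int u + 1/2)) * 0)) UNIV"
    by (intro has_sum_add has_sum_cmult_right f0 eta)
  also have "?this \<longleftrightarrow> ((\<lambda>m. alt_sign m * p powi (2 * m\<^sup>2 - 2 * (2 * u + 1) * m + (2 * u + 1)\<^sup>2 + 0\<^sup>2) *
      (of_int (sgn ((2 * u + 1) - m)) * parity_geo (p powi (- 2 * 0)) ((2 * u + 1) - m))) has_sum (?K * (1 / 2) * \<eta> ?q + (- ?K * (of_int u + 1/2)) * 0)) UNIV"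
  proof (rule has_sum_reindex_bij_witness[of _ "\<lambda>m. m - u - 1" "\<lambda>n. n + u + 1"], goal_cases)
    case (5 n)
    have e: "2 * (n + u + 1)\<^sup>2 - 2 * (2 * u + 1) * (n + u + 1) + (2 * u + 1)\<^sup>2 + 0\<^sup>2
       = 1 + 4 * tri u + 4 * tri n"
      using two_tri[of u] two_tri[of n] by (simp add: power2_eq_square algebra_simps)
    have "p powi (1 + 4 * tri u + 4 * tri n) = p * ?q powi tri u * ?q powi tri n"
      using p by (simp add: power_int_add power_int_power)
    thus ?case unfolding e by (simp add: parity_geo_one alt_sign_add algebra_simps)
  qed auto
  finally show ?thesis
    using has_sum_conv_coeff_geo[of "2 * u + 1" 0] has_sum_unique by fastforce
qed

definition axis_moment :: "nat \<Rightarrow> complex" where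
  "axis_moment i = (\<Sum>\<^sub>\<infinity>u. alt_sign u * p * (p ^ 4) powi tri u * of_int (2 * u + 1) ^ i)"

text \<open>Only \<open>R = 0\<close> with \<open>S\<close> odd survives, so the product of the
  generating functions has no positive power of \<open>y\<close>.\<close>

lemma moment_convolution:
  "(\<Sum>a\<le>i. \<Sum>b\<le>j. of_nat (i choose a) * of_nat (j choose b) *
        kron_moment p a b * theta_moment p (i - a) (j - b)) =
   (if j = 0 then \<eta> (p ^ 4) / 2 * axis_moment i else 0)"
proof -
  let ?T = "(\<lambda>u. (2 * u + 1, 0 :: int)) ` UNIV"
  let ?h = "\<lambda>(S, R). conv_coeff S R * of_int S ^ i * of_int R ^ j"
  have "(\<Sum>a\<le>i. \<Sum>b\<le>j. of_nat (i choose a) * of_nat (j choose b) *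
        kron_moment p a b * theta_moment p (i - a) (j - b)) = infsum ?h UNIV"
    using has_sum_conv_coeff[THEN infsumI] by simp
  also have "\<dots> = infsum ?h ?T"
  proof (rule infsum_cong_neutral)
    fix x :: "int \<times> int" assume x: "x \<in> UNIV - ?T"
    obtain S R where SR: "x = (S, R)" by (cases x)
    have "even (S + R) \<or> R \<noteq> 0"
      using x SR by (auto simp: image_iff) (metis oddE)
    thus "?h x = 0" using conv_coeff_even conv_coeff_zero SR by auto
  qed auto
  \<comment> \<open>The factor \<open>0 ^ j\<close> is \<open>R ^ j\<close> on the axis, with value
    1 at \<open>j = 0\<close>.\<close>
  also have "\<dots> = (\<Sum>\<^sub>\<infinity>u. (\<eta> (p ^ 4) / 2 * (alt_sign u * p * (p ^ 4) powi tri u * of_int (2 * u + 1) ^ i)) * 0 ^ j)"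
    by (subst infsum_reindex) (auto simp: inj_on_def o_def conv_coeff_axis mult.assoc)
  also have "\<dots> = (if j = 0 then \<eta> (p ^ 4) / 2 * axis_moment i else 0)"
    unfolding axis_moment_def by (simp only: infsum_cmult_left' infsum_cmult_right') simp
  finally show ?thesis .
qed

section \<open>Theta constants in the lowest moments\<close>

lemma axis_moment_1: "axis_moment 1 = p * \<eta> (p ^ 4)"
proof -
  have "axis_moment 1 = (\<Sum>\<^sub>\<infinity>u. p * (alt_sign u * of_int (2 * u + 1) * (p ^ 4) powi tri u))"
    unfolding axis_moment_def by (rule infsum_cong) (simp add: mult_ac)
  also have "\<dots> = p * \<eta> (p ^ 4)"
    by (simp add: \<eta>_def infsum_cmult_right')
  finally show ?thesis .
qed

text \<open>A difference of squares: sum and difference of the two moments are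
  \<open>\<theta>3 p\<close> and \<open>\<theta>4 p\<close>.\<close>

lemma even_moment_square_minus_odd_moment_square:
  "even_moment p 0 ^ 2 - odd_moment p 0 ^ 2 = \<theta>4 (p\<^sup>2) ^ 2"
proof -
  have "even_moment p 0 + odd_moment p 0 = \<theta>3 p"
    unfolding even_moment_def odd_moment_def \<theta>3_def
    using summable_even_gauss[of 0] summable_odd_gauss[of 0]
    by (subst infsum_add[symmetric]) (auto simp: even_gauss_def odd_gauss_def intro!: infsum_cong)
  moreover have "even_moment p 0 + - odd_moment p 0 = \<theta>4 p"
    unfolding even_moment_def odd_moment_def \<theta>4_def infsum_uminus[symmetric]
    using summable_even_gauss[of 0] summable_odd_gauss[of 0, THEN summable_on_uminus[THEN iffD2]]
    by (subst infsum_add[symmetric]) (auto simp: even_gauss_def odd_gauss_def alt_sign_def intro!: infsum_cong)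
  ultimately show ?thesis
    using \<theta>3_times_\<theta>4[OF p] by (simp add: power2_eq_square algebra_simps flip: \<open>_ = \<theta>3 p\<close> \<open>_ = \<theta>4 p\<close>)
qed

lemma even_moment_eq: "even_moment p i = (\<Sum>\<^sub>\<infinity>l. p powi (2 * l)\<^sup>2 * of_int (2 * l) ^ i)"
proof -
  have "even_moment p i = (\<Sum>\<^sub>\<infinity>n\<in>range (\<lambda>l. 2 * l). even_gauss p n * of_int n ^ i)"
    unfolding even_moment_def by (rule infsum_cong_neutral) (auto simp: even_gauss_def elim!: evenE)
  thus ?thesis
    by (subst (asm) infsum_reindex) (auto simp: inj_on_def o_def even_gauss_def)
qed

lemma odd_moment_eq: "odd_moment p i = (\<Sum>\<^sub>\<infinity>k. p powi (2 * k + 1)\<^sup>2 * of_int (2 * k + 1) ^ i)"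
proof -
  have "odd_moment p i = (\<Sum>\<^sub>\<infinity>n\<in>range (\<lambda>l. 2 * l + 1). odd_gauss p n * of_int n ^ i)"
    unfolding odd_moment_def by (rule infsum_cong_neutral) (auto simp: odd_gauss_def elim!: oddE)
  thus ?thesis
    by (subst (asm) infsum_reindex) (auto simp: inj_on_def o_def odd_gauss_def)
qed

lemma summable_even_moment: "(\<lambda>l. p powi (2 * l)\<^sup>2 * of_int (2 * l) ^ i) summable_on UNIV"
proof -
  have "(\<lambda>n. even_gauss p n * of_int n ^ i) summable_on range (\<lambda>l. 2 * l)"
    by (rule summable_on_subset[OF summable_even_gauss]) auto
  thus ?thesis by (subst (asm) summable_on_reindex) (auto simp: inj_on_def o_def even_gauss_def)
qed

lemma summable_odd_moment: "(\<lambda>k. p powi (2 * k + 1)\<^sup>2 * of_int (2 * k + 1) ^ i) summable_on UNIV"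
proof -
  have "(\<lambda>n. odd_gauss p n * of_int n ^ i) summable_on range (\<lambda>l. 2 * l + 1)"
    by (rule summable_on_subset[OF summable_odd_gauss]) auto
  thus ?thesis by (subst (asm) summable_on_reindex) (auto simp: inj_on_def o_def odd_gauss_def)
qed

text \<open>The parity split read backwards, starting from the square of
  \<open>\<eta> (p^4)\<close>. For \<open>a = k + l\<close>, \<open>b = k - l\<close> the product
  \<open>(2 * a + 1) * (2 * b + 1)\<close> is \<open>(2 * k + 1)^2 - (2 * l)^2\<close>, and
  \<open>1 + 4 * (tri a + tri b)\<close> is \<open>(2 * k + 1)^2 + (2 * l)^2\<close>. The two parity
  classes are equal, whence the 2.\<close>

lemma moment_wronskian:
  "2 * (even_moment p 0 * odd_moment p 2 - odd_moment p 0 * even_moment p 2) = p * \<eta> (p ^ 4) ^ 2"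
proof -
  let ?q = "p ^ 4"
  let ?h = "\<lambda>n. alt_sign n * of_int (2 * n + 1) * ?q powi tri n"
  let ?F = "\<lambda>(a, b). ?h a * ?h b"
  let ?e = "\<lambda>i l. p powi (2 * l)\<^sup>2 * of_int (2 * l) ^ i"
  let ?o = "\<lambda>i k. p powi (2 * k + 1)\<^sup>2 * of_int (2 * k + 1) ^ i"
  let ?G = "\<lambda>(k, l). p powi (2 * k + 1)\<^sup>2 * p powi (2 * l)\<^sup>2 * ((of_int (2 * k + 1))\<^sup>2 - (of_int (2 * l))\<^sup>2)"
  have sF: "?F summable_on UNIV" and F: "infsum ?F UNIV = \<eta> ?q * \<eta> ?q"
    using has_sum_product[OF summable_\<eta>[OF fourth_power_in_unit_disc] summable_\<eta>[OF fourth_power_in_unit_disc]]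
    by (simp_all add: \<eta>_def infsumI has_sum_imp_summable)
  have "((\<lambda>x. (case x of (k, l) \<Rightarrow> ?o 2 k * ?e 0 l) + - (case x of (k, l) \<Rightarrow> ?o 0 k * ?e 2 l)) has_sum
      (odd_moment p 2 * even_moment p 0 + - (odd_moment p 0 * even_moment p 2))) (UNIV \<times> UNIV)"
    unfolding even_moment_eq odd_moment_eq
    by (intro has_sum_add has_sum_uminusI has_sum_product summable_even_moment summable_odd_moment)
  also have "(\<lambda>x. (case x of (k, l) \<Rightarrow> ?o 2 k * ?e 0 l) + - (case x of (k, l) \<Rightarrow> ?o 0 k * ?e 2 l)) = ?G"
    by (auto simp: algebra_simps)
  finally have G: "infsum ?G UNIV = even_moment p 0 * odd_moment p 2 - odd_moment p 0 * even_moment p 2"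
    using infsumI by (fastforce simp: mult_ac)
  have e: "p * (?q powi tri (k + l) * ?q powi tri (k - l)) = p powi (2 * k + 1)\<^sup>2 * p powi (2 * l)\<^sup>2"
     for k l
  proof -
    have "p * (?q powi tri (k + l) * ?q powi tri (k - l)) = p powi (1 + 4 * (tri (k + l) + tri (k - l)))"
      using p by (simp add: power_int_add power_int_power distrib_left)
    also have "1 + 4 * (tri (k + l) + tri (k - l)) = (2 * k + 1)\<^sup>2 + (2 * l)\<^sup>2"
      using two_tri[of k] tri_add_even[of k l] by (simp add: power2_eq_square algebra_simps)
    finally show ?thesis using p by (simp add: power_int_add)
  qed
  have 1: "p * ?F (k + l, k - l) = ?G (k, l)" for k l
    unfolding e[symmetric] by (simp add: alt_sign_add alt_sign_diff algebra_simps power2_eq_square)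
       (simp add: alt_sign_def)
  have 2: "?F (k + l, l - k - 1) = ?F (k + l, k - l)" for k l
  proof -
    have "?h (l - k - 1) = ?h (k - l)"
      using tri_reflect[of "k - l"] by (simp add: alt_sign_def algebra_simps)
    thus ?thesis by simp
  qed
  have "p * (\<eta> ?q * \<eta> ?q) = 2 * (p * (\<Sum>\<^sub>\<infinity>(k, l)\<in>UNIV. ?F (k + l, k - l)))"
    using infsum_int_pair_parity_split[OF sF] unfolding F 2 by simp
  also have "p * (\<Sum>\<^sub>\<infinity>(k, l)\<in>UNIV. ?F (k + l, k - l)) = infsum ?G UNIV"
    unfolding infsum_cmult_right'[symmetric] by (rule infsum_cong) (use 1 in auto)
  finally show ?thesis unfolding G by (simp add: power2_eq_square)
qed

lemma even_moment_odd_index: "odd i \<Longrightarrow> even_moment p i = 0"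
proof -
  assume "odd i"
  have "even_moment p i = (\<Sum>\<^sub>\<infinity>n. - (even_gauss p n * of_int n ^ i))"
    unfolding even_moment_def
    by (rule infsum_reindex_bij_witness[of _ uminus uminus]) (use \<open>odd i\<close> in \<open>auto simp: even_gauss_def\<close>)
  thus ?thesis by (simp add: infsum_uminus even_moment_def)
qed

lemma odd_moment_odd_index: "odd i \<Longrightarrow> odd_moment p i = 0"
proof -
  assume "odd i"
  have "odd_moment p i = (\<Sum>\<^sub>\<infinity>n. - (odd_gauss p n * of_int n ^ i))"
    unfolding odd_moment_def
    by (rule infsum_reindex_bij_witness[of _ uminus uminus]) (use \<open>odd i\<close> in \<open>auto simp: odd_gauss_def\<close>)
  thus ?thesis by (simp add: infsum_uminus odd_moment_def)
qed

lemma axis_moment_even_index: "even i \<Longrightarrow> axis_moment i = 0"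
proof -
  assume "even i"
  have "axis_moment i = (\<Sum>\<^sub>\<infinity>u. - (alt_sign u * p * (p ^ 4) powi tri u * of_int (2 * u + 1) ^ i))"
    unfolding axis_moment_def
  proof (rule infsum_reindex_bij_witness[of _ "\<lambda>u. - 1 - u" "\<lambda>u. - 1 - u"], goal_cases)
    case (5 u)
    have "2 * (- 1 - u) + 1 = - (2 * u + 1)" by simp
    hence "of_int (2 * (- 1 - u) + 1) ^ i = (of_int (2 * u + 1) ^ i :: complex)"
      using \<open>even i\<close> by (simp only: of_int_minus power_minus_even)
    thus ?case by (simp add: alt_sign_def)
  qed auto
  thus ?thesis by (simp add: infsum_uminus axis_moment_def)
qed

end

subsection \<open>Triangular factorization of the coefficient matrix\<close>

unbundle no vec_syntax
no_notation Matrix.vec_index (infixl "$" 100)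
unbundle fps_syntax

text \<open>Series in two variables are series in \<open>y\<close> over series in \<open>x\<close>.
  A series in \<open>x\<close> is embedded by \<open>fps_const\<close>, a series in \<open>y\<close>
  by \<open>fps_lift\<close>.\<close>

definition fps_lift :: "complex fps \<Rightarrow> complex fps fps" where
  "fps_lift a = Abs_fps (\<lambda>j. fps_const (a $ j))"

lemma fps_lift_nth [simp]: "fps_lift a $ j = fps_const (a $ j)"
  by (simp add: fps_lift_def)

lemma fps_lift_mult: "fps_lift (a * b) = fps_lift a * fps_lift b"
proof (rule fps_ext)
  have *: "fps_const (sum h I) = (\<Sum>i\<in>I. fps_const (h i))" for h :: "nat \<Rightarrow> complex" and I
    by (induction I rule: infinite_finite_induct) (auto simp flip: fps_const_add)
  show "fps_lift (a * b) $ n = (fps_lift a * fps_lift b) $ n" for n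
    by (simp add: fps_mult_nth *)
qed

lemma fps_lift_diff: "fps_lift (a - b) = fps_lift a - fps_lift b"
  by (rule fps_ext) (simp flip: fps_const_sub)

lemma fps_lift_const: "fps_lift (fps_const c) = fps_const (fps_const c)"
  by (rule fps_ext) auto

lemma fps_lift_power: "fps_lift (a ^ n) = fps_lift a ^ n"
proof (induction n)
  case 0
  have "fps_lift 1 = 1" by (rule fps_ext) auto
  thus ?case by simp
qed (simp add: fps_lift_mult)

lemma bivariate_nth:
  "(F * (fps_const a * fps_lift b)) $ j $ i =
     (\<Sum>k\<le>i. \<Sum>l\<le>j. F $ l $ k * (a $ (i - k) * b $ (j - l)))"
proof -
  have "(F * (fps_const a * fps_lift b)) $ j $ i = (\<Sum>l\<le>j. (F $ l * a) $ i * b $ (j - l))"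
    by (subst mult.assoc[symmetric], subst fps_mult_nth) (simp add: fps_sum_nth atLeast0AtMost)
  also have "\<dots> = (\<Sum>l\<le>j. \<Sum>k\<le>i. F $ l $ k * (a $ (i - k) * b $ (j - l)))"
    by (simp add: fps_mult_nth sum_distrib_right atLeast0AtMost mult.assoc)
  also have "\<dots> = (\<Sum>k\<le>i. \<Sum>l\<le>j. F $ l $ k * (a $ (i - k) * b $ (j - l)))"
    by (rule sum.swap)
  finally show ?thesis .
qed

text \<open>The series \<open>f\<close> with \<open>f(x,y) (A(x)A(y) - C(x)C(y)) = g(x)\<close> is, up to factors depending on one
  variable only, the geometric series in \<open>W(x)W(y)\<close>, where \<open>W\<close> vanishes to second order. Hence its
  coefficient matrix is a product of two triangular matrices.\<close>
lemma triangular_factorization: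
  fixes f :: "nat \<Rightarrow> nat \<Rightarrow> complex" and A C g :: "complex fps"
  defines "\<delta> \<equiv> (A $ 0)\<^sup>2 - (C $ 0)\<^sup>2"
  defines "w \<equiv> (A $ 0 * C $ 2 - C $ 0 * A $ 2) / \<delta>"
  assumes conv: "\<And>i j. (\<Sum>a\<le>i. \<Sum>b\<le>j. f a b * (A $ (i - a) * A $ (j - b) - C $ (i - a) * C $ (j - b))) =
      (if j = 0 then g $ i else 0)"
    and odd: "A $ 1 = 0" "C $ 1 = 0" "g $ 0 = 0" and \<delta>: "\<delta> \<noteq> 0"
  shows "\<exists>\<alpha> \<beta>. (\<forall>i j. j < m \<longrightarrow> f (2 * i + 1) (2 * j) = (\<Sum>n<m. \<alpha> i n * \<beta> n j)) \<and>
    (\<forall>i n. i < n \<longrightarrow> \<alpha> i n = 0) \<and> (\<forall>n j. j < n \<longrightarrow> \<beta> n j = 0) \<and>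
    (\<forall>n. \<alpha> n n = g $ 1 * w ^ n) \<and> (\<forall>n. \<beta> n n = w ^ n / \<delta>)"
proof -
  define F where "F = Abs_fps (\<lambda>j. Abs_fps (\<lambda>i. f i j))"
  \<comment> \<open>A hyperbolic rotation of the pair \<open>(A, C)\<close>: it preserves
    \<open>A(x)A(y) - C(x)C(y)\<close> up to the factor \<open>\<delta>\<close> and is chosen so
    that \<open>Q\<close> vanishes at 0 while \<open>P\<close> is invertible. Then
    \<open>W = Q / P\<close> has order at least 2, with second coefficient \<open>w\<close>.\<close>
  define P where "P = fps_const (A $ 0) * A - fps_const (C $ 0) * C"
  define Q where "Q = fps_const (A $ 0) * C - fps_const (C $ 0) * A"
  define W where "W = Q * inverse P"
  define V where "V = fps_shift 2 W"
  define D where "D = (fps_const (fps_const \<delta>) :: complex fps fps)"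
  have F_nth: "F $ j $ i = f i j" for i j by (simp add: F_def)
  have FT: "F * (fps_const A * fps_lift A - fps_const C * fps_lift C) = fps_const g"
  proof (rule fps_ext, rule fps_ext)
    fix j i
    show "(F * (fps_const A * fps_lift A - fps_const C * fps_lift C)) $ j $ i = fps_const g $ j $ i"
      using conv[of i j]
      by (simp only: right_diff_distrib fps_sub_nth bivariate_nth F_nth sum_subtractf) auto
  qed
  have Dk: "D = fps_const (fps_const (A $ 0)) ^ 2 - fps_const (fps_const (C $ 0)) ^ 2"
    by (simp add: D_def \<delta>_def power2_eq_square)
  have PQ: "fps_const P * fps_lift P - fps_const Q * fps_lift Q =
     D * (fps_const A * fps_lift A - fps_const C * fps_lift C)"
    unfolding P_def Q_def Dk fps_lift_diff fps_lift_mult fps_lift_const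
    fps_const_sub[symmetric] fps_const_mult[symmetric]
    by (simp add: algebra_simps power2_eq_square del: fps_const_mult fps_const_sub)
  have P0: "P $ 0 = \<delta>" by (simp add: P_def \<delta>_def power2_eq_square)
  have invP: "P * inverse P = 1" using P0 \<delta> by (simp add: inverse_mult_eq_1')
  have invP0: "inverse P $ 0 = 1 / \<delta>" using P0 by (simp add: fps_inverse_nth_0 field_simps)
  have Q: "Q = P * W" unfolding W_def using invP by (metis mult.left_commute mult.right_neutral)
  have Q01: "Q $ 0 = 0" "Q $ 1 = 0" using odd by (simp_all add: Q_def)
  have W01: "W $ 0 = 0" "W $ 1 = 0" using Q01 by (simp_all add: W_def fps_mult_nth)
  have W2: "W $ 2 = w"
    using Q01 by (simp add: W_def fps_mult_nth numeral_2_eq_2 invP0) (simp add: Q_def w_def P0 numeral_2_eq_2 divide_inverse)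
  have WV: "W = fps_X ^ 2 * V"
  proof (rule fps_ext)
    fix n
    show "W $ n = (fps_X ^ 2 * V) $ n"
    proof (cases "n < 2")
      case True
      hence "n = 0 \<or> n = 1" by auto
      thus ?thesis using W01 by (auto simp: fps_X_power_mult_nth)
    next
      case False
      then obtain k where "n = k + 2" by (metis add.commute le_Suc_ex not_less)
      thus ?thesis by (simp add: V_def fps_X_power_mult_nth)
    qed
  qed
  have V0: "V $ 0 = w" using W2 by (simp add: V_def numeral_2_eq_2)
  have Wpow: "W ^ n = fps_X ^ (2 * n) * V ^ n" for n
    unfolding WV power_mult_distrib power_mult ..
  define z where "z = fps_const W * fps_lift W"
  define I where "I = fps_const (inverse P) * fps_lift (inverse P)"
  have PI: "fps_const P * fps_lift P * I = 1"
  proof -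
    have "fps_const P * fps_lift P * I = fps_const (P * inverse P) * fps_lift (P * inverse P)"
      by (simp add: I_def fps_lift_mult mult_ac flip: fps_const_mult)
    thus ?thesis unfolding invP using fps_lift_power[of 1 0] by simp
  qed
  have "F * (fps_const P * fps_lift P) * (1 - z) = D * fps_const g"
  proof -
    have "F * (fps_const P * fps_lift P) * (1 - z) = F * (fps_const P * fps_lift P - fps_const Q * fps_lift Q)"
      unfolding z_def Q fps_lift_mult fps_const_mult[symmetric] by (simp add: algebra_simps del: fps_const_mult)
    also have "\<dots> = D * (F * (fps_const A * fps_lift A - fps_const C * fps_lift C))"
      unfolding PQ by (rule mult.left_commute)
    finally show ?thesis unfolding FT .
  qed
  \<comment> \<open>A truncated geometric sum replaces \<open>1 / (1 - z)\<close>. The remainder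
    \<open>F * z^m\<close> has order at least \<open>2 * m\<close> in \<open>y\<close>, so it does
    not reach the columns \<open>2 * j\<close> with \<open>j < m\<close>.\<close>
  hence "(F * (fps_const P * fps_lift P) * (1 - z)) * (I * (\<Sum>n<m. z ^ n)) = D * fps_const g * (I * (\<Sum>n<m. z ^ n))"
    by simp
  moreover have "(F * (fps_const P * fps_lift P) * (1 - z)) * (I * (\<Sum>n<m. z ^ n)) =
      F * (fps_const P * fps_lift P * I) * ((1 - z) * (\<Sum>n<m. z ^ n))" by (simp only: mult_ac)
  ultimately have "F * (1 - z ^ m) = D * fps_const g * (I * (\<Sum>n<m. z ^ n))"
    by (simp add: PI one_diff_power_eq)
  also have "\<dots> = (\<Sum>n<m. fps_const (fps_const \<delta> * g * inverse P * W ^ n) * fps_lift (inverse P * W ^ n))"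
    by (simp add: sum_distrib_left D_def I_def z_def power_mult_distrib fps_lift_mult fps_lift_power mult_ac
        flip: fps_const_mult fps_const_power)
  finally have main: "F = F * (fps_const (W ^ m) * fps_lift (W ^ m)) +
      (\<Sum>n<m. fps_const (fps_const \<delta> * g * inverse P * W ^ n) * fps_lift (inverse P * W ^ n))"
    by (simp add: z_def power_mult_distrib fps_lift_power algebra_simps flip: fps_const_power)
  define \<alpha> where "\<alpha> = (\<lambda>i n. (fps_const \<delta> * g * inverse P * W ^ n) $ (2 * i + 1))"
  define \<beta> where "\<beta> = (\<lambda>n j. (inverse P * W ^ n) $ (2 * j))"
  show ?thesis
  proof (rule exI[of _ \<alpha>], rule exI[of _ \<beta>], intro conjI allI impI)
    fix i j assume j: "j < m"
    have "(F * (fps_const (W ^ m) * fps_lift (W ^ m))) $ (2 * j) $ (2 * i + 1) = 0"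
      unfolding bivariate_nth using j by (intro sum.neutral ballI) (auto simp: Wpow fps_X_power_mult_nth)
    thus "f (2 * i + 1) (2 * j) = (\<Sum>n<m. \<alpha> i n * \<beta> n j)"
      using arg_cong[OF main, of "\<lambda>F. F $ (2 * j) $ (2 * i + 1)"]
      by (simp add: F_nth fps_sum_nth \<alpha>_def \<beta>_def)
  next
    define h where "h = fps_shift 1 g"
    have g: "g = fps_X * h"
      by (rule fps_ext) (use odd in \<open>auto simp: h_def\<close>)
    have \<alpha>: "fps_const \<delta> * g * inverse P * W ^ n = fps_X ^ (2 * n + 1) * (fps_const \<delta> * h * inverse P * V ^ n)" for n
      unfolding g Wpow by (simp add: mult_ac)
    show "\<alpha> i n = 0" if "i < n" for i n
      unfolding \<alpha>_def \<alpha> using that by (subst fps_X_power_mult_nth) auto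
    show "\<alpha> n n = g $ 1 * w ^ n" for n
      unfolding \<alpha>_def \<alpha> using \<delta> by (subst fps_X_power_mult_nth) (auto simp: fps_power_zeroth P0 V0 h_def)
    have \<beta>: "inverse P * W ^ n = fps_X ^ (2 * n) * (inverse P * V ^ n)" for n
      unfolding Wpow by (simp add: mult_ac)
    show "\<beta> n j = 0" if "j < n" for n j
      unfolding \<beta>_def \<beta> using that by (subst fps_X_power_mult_nth) auto
    show "\<beta> n n = w ^ n / \<delta>" for n
      unfolding \<beta>_def \<beta> by (subst fps_X_power_mult_nth) (auto simp: fps_power_zeroth P0 V0 field_simps)
  qed
qed

subsection \<open>Determinants and multiple sums\<close>

lemma det_triangular_product:
  fixes a :: "nat \<Rightarrow> nat \<Rightarrow> complex"
  assumes a: "\<And>i j. i < m \<Longrightarrow> j < m \<Longrightarrow> a i j = (\<Sum>n<m. \<alpha> i n * \<beta> n j)"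
    and \<alpha>: "\<And>i n. i < n \<Longrightarrow> \<alpha> i n = 0" and \<beta>: "\<And>n j. j < n \<Longrightarrow> \<beta> n j = 0"
  shows "Determinant.det (Matrix.mat m m (\<lambda>(i, j). a i j)) = (\<Prod>n<m. \<alpha> n n * \<beta> n n)"
proof -
  let ?A = "Matrix.mat m m (\<lambda>(i, n). \<alpha> i n)" and ?B = "Matrix.mat m m (\<lambda>(n, j). \<beta> n j)"
  have "Matrix.mat m m (\<lambda>(i, j). a i j) = ?A * ?B"
    by (rule eq_matI) (auto simp: a scalar_prod_def lessThan_atLeast0 intro!: sum.cong)
  hence "Determinant.det (Matrix.mat m m (\<lambda>(i, j). a i j)) = Determinant.det ?A * Determinant.det ?B"
    by (simp add: Determinant.det_mult[of _ m])
  also have "Determinant.det ?A = prod_list (diag_mat ?A)"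
    using \<alpha> by (intro Determinant.det_lower_triangular[of m]) auto
  also have "Determinant.det ?B = prod_list (diag_mat ?B)"
    using \<beta> by (intro Determinant.det_upper_triangular[of _ m]) auto
  finally show ?thesis
    by (simp add: prod_list_diag_prod prod.distrib lessThan_atLeast0)
qed

text \<open>Coefficients of \<open>t^j\<close> in the Newton basis with nodes \<open>x\<close>, that
  is, complete homogeneous symmetric polynomials. The recursion is multiplication by
  \<open>t = (t - x n) + x n\<close>. They make the Vandermonde matrix a product of two triangular
  ones.\<close>

primrec newton_coeff :: "(nat \<Rightarrow> complex) \<Rightarrow> nat \<Rightarrow> nat \<Rightarrow> complex" where
  "newton_coeff x n 0 = (if n = 0 then 1 else 0)"
| "newton_coeff x n (Suc j) = (if n = 0 then 0 else newton_coeff x (n - 1) j) + x n * newton_coeff x n j"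

lemma newton_coeff_eq_0: "j < n \<Longrightarrow> newton_coeff x n j = 0"
  by (induction j arbitrary: n) auto

lemma newton_coeff_diag [simp]: "newton_coeff x n n = 1"
  by (induction n) (auto simp: newton_coeff_eq_0)

lemma power_eq_newton:
  "t ^ j = (\<Sum>n\<le>j. (\<Prod>l<n. t - x l) * newton_coeff x n j)"
proof (induction j)
  case (Suc j)
  let ?N = "\<lambda>n. \<Prod>l<n. t - x l"
  have "(\<Sum>n\<le>Suc j. ?N n * newton_coeff x n (Suc j)) =
      (\<Sum>n\<le>Suc j. ?N n * (if n = 0 then 0 else newton_coeff x (n - 1) j)) +
      (\<Sum>n\<le>Suc j. ?N n * (x n * newton_coeff x n j))"
    by (simp only: newton_coeff.simps distrib_left sum.distrib)
  also have "(\<Sum>n\<le>Suc j. ?N n * (if n = 0 then 0 else newton_coeff x (n - 1) j)) =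
      (\<Sum>n\<le>j. ?N (Suc n) * newton_coeff x n j)"
    by (subst sum.atMost_Suc_shift) simp
  also have "(\<Sum>n\<le>Suc j. ?N n * (x n * newton_coeff x n j)) = (\<Sum>n\<le>j. ?N n * (x n * newton_coeff x n j))"
    by (simp add: newton_coeff_eq_0)
  also have "(\<Sum>n\<le>j. ?N (Suc n) * newton_coeff x n j) + (\<Sum>n\<le>j. ?N n * (x n * newton_coeff x n j)) =
      t * (\<Sum>n\<le>j. ?N n * newton_coeff x n j)"
    unfolding sum.distrib[symmetric] sum_distrib_left by (rule sum.cong) (auto simp: algebra_simps)
  finally show ?case using Suc.IH by simp
qed simp

lemma det_vandermonde:
  "Determinant.det (Matrix.mat m m (\<lambda>(i, j). x i ^ j)) = (\<Prod>i<m. \<Prod>l<i. (x i - x l :: complex))"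
proof -
  have "x i ^ j = (\<Sum>n<m. (\<Prod>l<n. x i - x l) * newton_coeff x n j)" if "j < m" for i j
  proof -
    have "(\<Sum>n<m. (\<Prod>l<n. x i - x l) * newton_coeff x n j) = (\<Sum>n\<le>j. (\<Prod>l<n. x i - x l) * newton_coeff x n j)"
      using that by (intro sum.mono_neutral_right) (auto simp: newton_coeff_eq_0)
    thus ?thesis using power_eq_newton[of "x i" j x] by simp
  qed
  from det_triangular_product[of m "\<lambda>i j. x i ^ j" "\<lambda>i n. \<Prod>l<n. x i - x l" "newton_coeff x", OF this]
  show ?thesis by (auto simp: newton_coeff_eq_0)
qed

lemma has_sum_prod_PiE:
  fixes f :: "'a \<Rightarrow> 'b \<Rightarrow> complex"
  assumes "finite A" "\<And>x. x \<in> A \<Longrightarrow> f x summable_on B x"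
  shows "((\<lambda>g. \<Prod>x\<in>A. f x (g x)) has_sum (\<Prod>x\<in>A. infsum (f x) (B x))) (PiE A B)"
  using assms
proof (induction A rule: finite_induct)
  case (insert a A)
  let ?P = "\<lambda>g. \<Prod>x\<in>A. f x (g x)"
  have IH: "(?P has_sum (\<Prod>x\<in>A. infsum (f x) (B x))) (PiE A B)"
    using insert by auto
  have "((\<lambda>(y, g). f a y * ?P g) has_sum (infsum (f a) (B a) * (\<Prod>x\<in>A. infsum (f x) (B x)))) (B a \<times> PiE A B)"
    using has_sum_product[of "f a" "B a" ?P "PiE A B"] insert.prems IH[THEN infsumI] IH[THEN has_sum_imp_summable] by simp
  also have "?this \<longleftrightarrow> ((\<lambda>g. \<Prod>x\<in>insert a A. f x (g x)) has_sum (infsum (f a) (B a) * (\<Prod>x\<in>A. infsum (f x) (B x))))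
      (PiE (insert a A) B)"
  \<comment> \<open>Resetting the value at \<open>a\<close> to \<open>undefined\<close> makes the
    restriction extensional on \<open>A\<close> again.\<close>
  proof (rule has_sum_reindex_bij_witness[of _ "\<lambda>g. (g a, g(a := undefined))" "\<lambda>(y, g). g(a := y)"], goal_cases)
    case (1 z)
    thus ?case using insert.hyps by (auto simp: PiE_def extensional_def fun_eq_iff)
  next
    case (2 z)
    thus ?case by (auto simp: PiE_def extensional_def Pi_def)
  next
    case (4 g)
    thus ?case using insert.hyps by (auto simp: PiE_def extensional_def Pi_def)
  next
    case (5 z)
    obtain y g where z: "z = (y, g)" by (cases z)
    have "(\<Prod>x\<in>A. f x ((g(a := y)) x)) = ?P g"
      using insert.hyps by (intro prod.cong) auto
    thus ?case using insert.hyps z by simp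
  qed auto
  finally show ?case using insert.hyps by simp
qed (auto intro!: has_sum_finiteI)

text \<open>For fixed \<open>\<pi>\<close> the inner sum is the sign of \<open>\<pi>\<close> times
  the determinant with rows permuted by \<open>\<pi>\<close>, hence the determinant itself. There
  are \<open>m!\<close> choices of \<open>\<pi>\<close>.\<close>

lemma sum_permutation_pairs:
  fixes M :: "nat \<Rightarrow> nat \<Rightarrow> complex"
  shows "(\<Sum>\<pi> | \<pi> permutes {0..<m}. \<Sum>\<tau> | \<tau> permutes {0..<m}.
      signof \<pi> * signof \<tau> * (\<Prod>l\<in>{0..<m}. M (\<pi> l) (\<tau> l))) =
    fact m * Determinant.det (Matrix.mat m m (\<lambda>(i, j). M i j))"
proof -
  let ?D = "Determinant.det (Matrix.mat m m (\<lambda>(i, j). M i j))"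
  have *: "(\<Sum>\<tau> | \<tau> permutes {0..<m}. signof \<pi> * signof \<tau> * (\<Prod>l\<in>{0..<m}. M (\<pi> l) (\<tau> l))) = ?D"
    if \<pi>: "\<pi> permutes {0..<m}" for \<pi>
  proof -
    have lt: "\<pi> i < m" if "i < m" for i using permutes_in_image[OF \<pi>, of i] that by simp
    have lt': "\<tau> i < m" if "i < m" "\<tau> permutes {0..<m}" for i \<tau>
      using permutes_in_image[OF that(2), of i] that by simp
    have "(\<Sum>\<tau> | \<tau> permutes {0..<m}. signof \<pi> * signof \<tau> * (\<Prod>l\<in>{0..<m}. M (\<pi> l) (\<tau> l))) =
       signof \<pi> * Determinant.det (Matrix.mat m m (\<lambda>(i, j). Matrix.mat m m (\<lambda>(i, j). M i j) $$ (\<pi> i, j)))"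
      by (subst Determinant.det_def'[of _ m])
         (auto simp: sum_distrib_left mult.assoc lt lt' intro!: sum.cong prod.cong)
    also have "\<dots> = signof \<pi> * (signof \<pi> * ?D)"
      by (subst Determinant.det_permute_rows[OF _ \<pi>]) auto
    also have "\<dots> = ?D" by (simp add: sign_def)
    finally show ?thesis .
  qed
  have "card {\<pi>. \<pi> permutes {0..<m}} = fact m" by (simp add: card_permutations)
  thus ?thesis by (simp add: *)
qed

text \<open>Each pair of permutations gives a product over coordinates, so convergence of the m-fold
  sum follows from the one-variable sums. Vectors are indexed from 1 and matrices from 0, hence the
  shifts by \<open>Suc\<close>.\<close>

lemma andreief:
  fixes w :: "'z \<Rightarrow> complex" and \<phi> \<chi> :: "nat \<Rightarrow> 'z \<Rightarrow> complex"
  assumes s: "\<And>i j. (\<lambda>z. w z * \<phi> i z * \<chi> j z) summable_on G"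
  shows "((\<lambda>v. (\<Prod>l=1..m. w (v l)) * Determinant.det (Matrix.mat m m (\<lambda>(l, i). \<phi> i (v (Suc l)))) *
        Determinant.det (Matrix.mat m m (\<lambda>(l, j). \<chi> j (v (Suc l))))) has_sum
      fact m * Determinant.det (Matrix.mat m m (\<lambda>(i, j). \<Sum>\<^sub>\<infinity>z\<in>G. w z * \<phi> i z * \<chi> j z))) ({1..m} \<rightarrow>\<^sub>E G)"
proof -
  let ?S = "{\<pi>. \<pi> permutes {0..<m}}"
  let ?M = "\<lambda>i j. \<Sum>\<^sub>\<infinity>z\<in>G. w z * \<phi> i z * \<chi> j z"
  have sh: "prod h {1..m} = (\<Prod>l\<in>{0..<m}. h (Suc l))" for h :: "nat \<Rightarrow> complex"
    by (simp add: prod.atLeast1_atMost_eq lessThan_atLeast0)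
  have "((\<lambda>v. \<Sum>\<pi>\<in>?S. \<Sum>\<tau>\<in>?S. signof \<pi> * signof \<tau> *
      (\<Prod>l=1..m. w (v l) * \<phi> (\<pi> (l - 1)) (v l) * \<chi> (\<tau> (l - 1)) (v l)))
     has_sum (\<Sum>\<pi>\<in>?S. \<Sum>\<tau>\<in>?S. signof \<pi> * signof \<tau> * (\<Prod>l=1..m. ?M (\<pi> (l - 1)) (\<tau> (l - 1))))) ({1..m} \<rightarrow>\<^sub>E G)"
    by (intro has_sum_finite_sum has_sum_cmult_right has_sum_prod_PiE s finite_permutations) auto
  also have "(\<Sum>\<pi>\<in>?S. \<Sum>\<tau>\<in>?S. signof \<pi> * signof \<tau> * (\<Prod>l=1..m. ?M (\<pi> (l - 1)) (\<tau> (l - 1)))) =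
      fact m * Determinant.det (Matrix.mat m m (\<lambda>(i, j). ?M i j))"
    using sum_permutation_pairs[where m = m and M = ?M] unfolding sh by simp
  also have "(\<lambda>v. \<Sum>\<pi>\<in>?S. \<Sum>\<tau>\<in>?S. signof \<pi> * signof \<tau> *
      (\<Prod>l=1..m. w (v l) * \<phi> (\<pi> (l - 1)) (v l) * \<chi> (\<tau> (l - 1)) (v l))) =
     (\<lambda>v. (\<Prod>l=1..m. w (v l)) * Determinant.det (Matrix.mat m m (\<lambda>(l, i). \<phi> i (v (Suc l)))) *
        Determinant.det (Matrix.mat m m (\<lambda>(l, j). \<chi> j (v (Suc l)))))"
  proof
    fix v
    have lt: "\<tau> i < m" if "i < m" "\<tau> permutes {0..<m}" for i \<tau>
      using permutes_in_image[OF that(2), of i] that by simp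
    have d: "Determinant.det (Matrix.mat m m (\<lambda>(l, i). h i (v (Suc l)))) =
        (\<Sum>\<pi>\<in>?S. signof \<pi> * (\<Prod>l\<in>{0..<m}. h (\<pi> l) (v (Suc l))))" for h :: "nat \<Rightarrow> 'z \<Rightarrow> complex"
      by (subst Determinant.det_def'[of _ m]) (auto simp: lt intro!: sum.cong prod.cong)
    show "(\<Sum>\<pi>\<in>?S. \<Sum>\<tau>\<in>?S. signof \<pi> * signof \<tau> *
      (\<Prod>l=1..m. w (v l) * \<phi> (\<pi> (l - 1)) (v l) * \<chi> (\<tau> (l - 1)) (v l))) =
     (\<Prod>l=1..m. w (v l)) * Determinant.det (Matrix.mat m m (\<lambda>(l, i). \<phi> i (v (Suc l)))) *
        Determinant.det (Matrix.mat m m (\<lambda>(l, j). \<chi> j (v (Suc l))))"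
      unfolding d sh prod.distrib
      by (simp add: sum_distrib_left sum_distrib_right sum_product mult_ac)
  qed
  finally show ?thesis .
qed

subsection \<open>The multiple sum\<close>

lemma det_kron_moment:
  assumes p: "p \<noteq> 0" "norm p < 1"
  shows "Determinant.det (Matrix.mat m m (\<lambda>(i, j). kron_moment p (2 * i + 1) (2 * j) / 2)) =
    (\<Prod>n<m. fact (2 * n + 1) * fact (2 * n)) * (p * triangle_series (p\<^sup>2) ^ 4) ^ (m\<^sup>2)"
proof -
  define f where "f = (\<lambda>i j. kron_moment p i j / (fact i * fact j))"
  define A where "A = Abs_fps (\<lambda>i. even_moment p i / fact i)"
  define C where "C = Abs_fps (\<lambda>i. odd_moment p i / fact i)"
  define g where "g = Abs_fps (\<lambda>i. \<eta> (p ^ 4) / 2 * axis_moment p i / fact i)"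
  define T where "T = p * triangle_series (p\<^sup>2) ^ 4"
  have q: "p\<^sup>2 \<noteq> 0" "norm (p\<^sup>2) < 1" using square_in_unit_disc[OF p] .
  have \<delta>: "(fps_nth A 0)\<^sup>2 - (fps_nth C 0)\<^sup>2 = (\<theta>4 (p\<^sup>2))\<^sup>2"
    using even_moment_square_minus_odd_moment_square[OF p] by (simp add: A_def C_def)
  have \<delta>0: "(\<theta>4 (p\<^sup>2))\<^sup>2 \<noteq> 0" using \<theta>4_nonzero[OF q] by simp
  have eta: "\<eta> (p ^ 4) = 2 * triangle_series (p\<^sup>2) ^ 2 * \<theta>4 (p\<^sup>2)"
    using \<eta>_square_eq[OF q] \<psi>_eq_triangle_series[OF q] by (simp add: power2_eq_square power4_eq_xxxx mult_ac)
  have w: "(fps_nth A 0 * fps_nth C 2 - fps_nth C 0 * fps_nth A 2) / (\<theta>4 (p\<^sup>2))\<^sup>2 = T"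
  proof -
    have "fps_nth A 0 * fps_nth C 2 - fps_nth C 0 * fps_nth A 2 = p * \<eta> (p ^ 4) ^ 2 / 4"
      using moment_wronskian[OF p] by (simp add: A_def C_def fact_2 field_simps)
    also have "\<dots> = T * (\<theta>4 (p\<^sup>2))\<^sup>2"
      unfolding eta T_def by (simp add: power_mult_distrib)
    finally show ?thesis using \<delta>0 by simp
  qed
  have conv: "(\<Sum>a\<le>i. \<Sum>b\<le>j. f a b * (fps_nth A (i - a) * fps_nth A (j - b) - fps_nth C (i - a) * fps_nth C (j - b))) =
      (if j = 0 then fps_nth g i else 0)" for i j
  proof -
    have "(\<Sum>a\<le>i. \<Sum>b\<le>j. f a b * (fps_nth A (i - a) * fps_nth A (j - b) - fps_nth C (i - a) * fps_nth C (j - b))) =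
      (\<Sum>a\<le>i. \<Sum>b\<le>j. of_nat (i choose a) * of_nat (j choose b) *
        kron_moment p a b * theta_moment p (i - a) (j - b)) / (fact i * fact j)"
      unfolding sum_divide_distrib
      by (intro sum.cong refl) (simp add: f_def A_def C_def theta_moment_def binomial_fact field_simps)
    also have "\<dots> = (if j = 0 then fps_nth g i else 0)"
      unfolding moment_convolution[OF p] by (simp add: g_def)
    finally show ?thesis .
  qed
  have odd: "fps_nth A 1 = 0" "fps_nth C 1 = 0" "fps_nth g 0 = 0"
    using even_moment_odd_index[OF p, of 1] odd_moment_odd_index[OF p, of 1] axis_moment_even_index[OF p, of 0]
    by (simp_all add: A_def C_def g_def)
  obtain \<alpha> \<beta> where
    f: "\<And>i j. j < m \<Longrightarrow> f (2 * i + 1) (2 * j) = (\<Sum>n<m. \<alpha> i n * \<beta> n j)" and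
    \<alpha>: "\<And>i n. i < n \<Longrightarrow> \<alpha> i n = 0" and \<beta>: "\<And>n j. j < n \<Longrightarrow> \<beta> n j = 0" and
    diag: "\<And>n. \<alpha> n n = fps_nth g 1 * T ^ n" "\<And>n. \<beta> n n = T ^ n / (\<theta>4 (p\<^sup>2))\<^sup>2"
    using triangular_factorization[where f = f and A = A and C = C and g = g and m = m,
          unfolded \<delta> w, OF conv odd \<delta>0] by blast
  \<comment> \<open>This 2 is cancelled by the division of the moments by 2, so the n-th diagonal
    pair yields \<open>T * T^n * T^n\<close>, apart from the factorials.\<close>
  have g1: "fps_nth g 1 / (\<theta>4 (p\<^sup>2))\<^sup>2 = 2 * T"
  proof -
    have "fps_nth g 1 = \<eta> (p ^ 4) / 2 * (p * \<eta> (p ^ 4))"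
      using axis_moment_1[OF p] by (simp add: g_def)
    also have "\<dots> = 2 * T * (\<theta>4 (p\<^sup>2))\<^sup>2"
      unfolding eta T_def by (simp add: power2_eq_square power4_eq_xxxx mult_ac)
    finally show ?thesis using \<delta>0 by simp
  qed
  have "Determinant.det (Matrix.mat m m (\<lambda>(i, j). kron_moment p (2 * i + 1) (2 * j) / 2)) =
    (\<Prod>n<m. (fact (2 * n + 1) * \<alpha> n n / 2) * (fact (2 * n) * \<beta> n n))"
  proof (rule det_triangular_product[where \<alpha> = "\<lambda>i n. fact (2 * i + 1) * \<alpha> i n / 2"
        and \<beta> = "\<lambda>n j. fact (2 * j) * \<beta> n j"])
    fix i j assume "i < m" and j: "j < m"
    have "kron_moment p (2 * i + 1) (2 * j) / 2 = fact (2 * i + 1) * fact (2 * j) / 2 * f (2 * i + 1) (2 * j)"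
      by (simp add: f_def del: fact_Suc)
    also have "\<dots> = (\<Sum>n<m. fact (2 * i + 1) * \<alpha> i n / 2 * (fact (2 * j) * \<beta> n j))"
      unfolding f[OF j] sum_distrib_left by (intro sum.cong) (auto simp: mult_ac)
    finally show "kron_moment p (2 * i + 1) (2 * j) / 2 =
       (\<Sum>n<m. fact (2 * i + 1) * \<alpha> i n / 2 * (fact (2 * j) * \<beta> n j))" .
  qed (use \<alpha> \<beta> in auto)
  also have "\<dots> = (\<Prod>n<m. (fact (2 * n + 1) * fact (2 * n)) * T ^ (2 * n + 1))"
  proof (rule prod.cong[OF refl])
    fix n
    have "(fact (2 * n + 1) * \<alpha> n n / 2) * (fact (2 * n) * \<beta> n n) =
       (fact (2 * n + 1) * fact (2 * n)) * ((fps_nth g 1 / (\<theta>4 (p\<^sup>2))\<^sup>2) / 2 * (T ^ n * T ^ n))"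
      unfolding diag by (simp add: field_simps)
    also have "\<dots> = (fact (2 * n + 1) * fact (2 * n)) * T ^ (2 * n + 1)"
      unfolding g1 by (simp add: power_even_eq power2_eq_square)
    finally show "(fact (2 * n + 1) * \<alpha> n n / 2) * (fact (2 * n) * \<beta> n n) =
       (fact (2 * n + 1) * fact (2 * n)) * T ^ (2 * n + 1)" .
  qed
  also have "\<dots> = (\<Prod>n<m. fact (2 * n + 1) * fact (2 * n)) * T ^ (\<Sum>n<m. 2 * n + 1)"
    by (simp only: prod.distrib power_sum)
  also have "(\<Sum>n<m. 2 * n + 1) = m\<^sup>2"
    by (induction m) (auto simp: power2_eq_square)
  finally show ?thesis unfolding T_def .
qed

definition same_sign :: "(int \<times> int) set" where
  "same_sign = {(k, r). 0 < k \<and> 0 < r \<or> k \<le> 0 \<and> r \<le> 0}"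

definition kr_weight :: "complex \<Rightarrow> int \<times> int \<Rightarrow> complex" where
  "kr_weight p = (\<lambda>(k, r). (if k \<le> 0 then - 1 else 1) * p powi ((r + 2 * k - 1)\<^sup>2 - r\<^sup>2) * of_int (r + 2 * k - 1))"

lemma has_sum_kr_weight:
  assumes p: "p \<noteq> 0" "norm p < 1"
  shows "((\<lambda>(k, r). kr_weight p (k, r) * (of_int (r + 2 * k - 1) ^ 2) ^ i * (of_int r ^ 2) ^ j) has_sum
      kron_moment p (2 * i + 1) (2 * j) / 2) same_sign"
proof -
  let ?h = "\<lambda>(s, r). kron p s r * of_int s ^ (2 * i + 1) * of_int r ^ (2 * j)"
  let ?P = "{(s, r :: int). s > (0 :: int)}" and ?N = "{(s, r :: int). s < (0 :: int)}"
  let ?D = "{(s, r :: int). \<bar>r\<bar> < s \<and> odd (s + r)}"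
  have sP: "?h summable_on ?P" and sN: "?h summable_on ?N"
    by (rule summable_on_subset[OF summable_kron[OF p]], simp)+
  have "kron_moment p (2 * i + 1) (2 * j) = infsum ?h (?P \<union> ?N)"
    unfolding kron_moment_def
    by (rule infsum_cong_neutral) (auto simp: kron_def split: if_splits)
  also have "\<dots> = infsum ?h ?P + infsum ?h ?N"
    using sP sN by (intro infsum_Un_disjoint) auto
  also have "infsum ?h ?N = infsum ?h ?P"
    by (rule infsum_reindex_bij_witness[of _ "\<lambda>(s, r). (- s, r)" "\<lambda>(s, r). (- s, r)"])
       (auto simp: kron_def)
  finally have "(?h has_sum (kron_moment p (2 * i + 1) (2 * j) / 2)) ?P"
    using sP by (simp add: has_sum_iff)
  also have "?this \<longleftrightarrow> (?h has_sum (kron_moment p (2 * i + 1) (2 * j) / 2)) ?D"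
    by (rule has_sum_cong_neutral) (auto simp: kron_def split: if_splits)
  also have "\<dots> \<longleftrightarrow> ((\<lambda>(k, r). kr_weight p (k, r) * (of_int (r + 2 * k - 1) ^ 2) ^ i * (of_int r ^ 2) ^ j) has_sum
      kron_moment p (2 * i + 1) (2 * j) / 2) same_sign"
  proof (rule has_sum_reindex_bij_witness[of _ "\<lambda>(k, r). (if k > 0 then r + 2 * k - 1 else - (r + 2 * k - 1), r)"
      "\<lambda>(s, r). (if r > 0 then (s - r + 1) div 2 else (1 - s - r) div 2, r)"], goal_cases)
    case (1 a)
    then obtain s r where a: "a = (s, r)" "\<bar>r\<bar> < s" "odd (s + r)" by auto
    then obtain t where "s + r = 2 * t + 1" by (elim oddE)
    hence "s = 2 * t + 1 - r" by simp
    with a show ?case by (auto simp: field_simps split: if_splits)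
  next
    case (2 a)
    then obtain s r where a: "a = (s, r)" "\<bar>r\<bar> < s" "odd (s + r)" by auto
    then obtain t where "s + r = 2 * t + 1" by (elim oddE)
    hence "s = 2 * t + 1 - r" by simp
    with a show ?case by (auto simp: same_sign_def field_simps split: if_splits)
  next
    case (3 b)
    thus ?case by (auto simp: same_sign_def split: if_splits)
  next
    case (4 b)
    thus ?case by (auto simp: same_sign_def split: if_splits)
  next
    case (5 a)
    then obtain s r where a: "a = (s, r)" "\<bar>r\<bar> < s" "odd (s + r)" by auto
    have k: "kron p s r = p powi (s\<^sup>2 - r\<^sup>2)"
      using a by (simp add: kron_def)
    show ?case
    proof (cases "r > 0")
      case True
      define k where "k = (s - r + 1) div 2"
      have s: "s = r + 2 * k - 1" and "k > 0" using a True unfolding k_def by presburger+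
      have "kr_weight p (k, r) = p powi (s\<^sup>2 - r\<^sup>2) * of_int s"
        unfolding kr_weight_def prod.case s[symmetric] using \<open>k > 0\<close> by simp
      moreover have "(of_int (r + 2 * k - 1) :: complex) ^ 2 = of_int s ^ 2"
        unfolding s[symmetric] by simp
      ultimately show ?thesis using True
        by (simp add: a(1) k k_def[symmetric] power_mult[of _ 2 i] power_mult[of _ 2 j] mult.assoc)
    next
      case False
      define k where "k = (1 - s - r) div 2"
      have s: "- s = r + 2 * k - 1" and "k \<le> 0" using a False unfolding k_def by presburger+
      have "kr_weight p (k, r) = p powi (s\<^sup>2 - r\<^sup>2) * of_int s"
        unfolding kr_weight_def prod.case s[symmetric] using \<open>k \<le> 0\<close> by simp
      moreover have "(of_int (r + 2 * k - 1) :: complex) ^ 2 = of_int s ^ 2"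
        unfolding s[symmetric] by simp
      ultimately show ?thesis using False
        by (simp add: a(1) k k_def[symmetric] power_mult[of _ 2 i] power_mult[of _ 2 j] mult.assoc)
    qed
  qed auto
  finally show ?thesis .
qed

lemma prod_pairs_upper:
  fixes h :: "nat \<Rightarrow> nat \<Rightarrow> complex"
  shows "(\<Prod>(i, j)\<in>{(i, j). 1 \<le> i \<and> i < j \<and> j \<le> m}. h i j) = (\<Prod>i<m. \<Prod>l<i. h (Suc l) (Suc i))"
proof -
  have "(\<Prod>i<m. \<Prod>l<i. h (Suc l) (Suc i)) = (\<Prod>(i, l)\<in>(SIGMA i:{..<m}. {..<i}). h (Suc l) (Suc i))"
    by (rule prod.Sigma) auto
  also have "\<dots> = (\<Prod>(i, j)\<in>{(i, j). 1 \<le> i \<and> i < j \<and> j \<le> m}. h i j)"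
    by (rule prod.reindex_bij_witness[of _ "\<lambda>(i, j). (j - 1, i - 1)" "\<lambda>(i, l). (Suc l, Suc i)"]) auto
  finally show ?thesis by simp
qed

text \<open>Completing the square costs 1 in each coordinate, and
  \<open>m + m * (m - 1) = m^2\<close>.\<close>

lemma two_times_q_exponent:
  "2 * q_exponent m k r = (\<Sum>j=1..m. (r j + 2 * k j - 1)\<^sup>2 - (r j)\<^sup>2) - (int m)\<^sup>2"
proof -
  have "even (int m * (int m - 1))" by auto
  hence "2 * (int m * (int m - 1) div 2) = int m * (int m - 1)" by simp
  moreover have "2 * (\<Sum>j=1..m. 2 * ((k j)\<^sup>2 + k j * r j - k j) - r j) =
      (\<Sum>j=1..m. (r j + 2 * k j - 1)\<^sup>2 - (r j)\<^sup>2 - 1)"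
    unfolding sum_distrib_left by (rule sum.cong) (auto simp: power2_eq_square algebra_simps)
  moreover have "(\<Sum>j=1..m. (r j + 2 * k j - 1)\<^sup>2 - (r j)\<^sup>2 - 1) =
      (\<Sum>j=1..m. (r j + 2 * k j - 1)\<^sup>2 - (r j)\<^sup>2) - int m"
    by (subst sum_subtractf[of _ "\<lambda>_. 1"]) simp
  ultimately show ?thesis unfolding q_exponent_def right_diff_distrib
    by (simp add: power2_eq_square algebra_simps)
qed

definition vec_term :: "nat \<Rightarrow> complex \<Rightarrow> (nat \<Rightarrow> int \<times> int) \<Rightarrow> complex" where
  "vec_term m p v = (\<Prod>l=1..m. kr_weight p (v l)) *
     Determinant.det (Matrix.mat m m (\<lambda>(l, i). ((of_int (snd (v (Suc l)) + 2 * fst (v (Suc l)) - 1))\<^sup>2) ^ i)) *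
     Determinant.det (Matrix.mat m m (\<lambda>(l, j). ((of_int (snd (v (Suc l))))\<^sup>2) ^ j))"

text \<open>The four factors of each pair \<open>i < j\<close> group into
  \<open>r_i^2 - r_j^2\<close> and \<open>s_i^2 - s_j^2\<close> with \<open>s = r + 2 k - 1\<close>.
  The Vandermonde products use the opposite order in both, so the signs cancel.\<close>

lemma vec_term_eq:
  assumes p: "p \<noteq> 0"
  shows "vec_term m p (\<lambda>l\<in>{1..m}. (k l, r l)) =
     p ^ (m\<^sup>2) * ((- 1) ^ card {l\<in>{1..m}. k l \<le> 0} * q_term m (p\<^sup>2) k r)"
proof -
  let ?v = "\<lambda>l\<in>{1..m}. (k l, r l)"
  define s where "s = (\<lambda>l. r l + 2 * k l - 1)"
  have d1: "Matrix.mat m m (\<lambda>(l, i). ((of_int (snd (?v (Suc l)) + 2 * fst (?v (Suc l)) - 1))\<^sup>2 :: complex) ^ i) =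
      Matrix.mat m m (\<lambda>(l, i). (of_int (s (Suc l)))\<^sup>2 ^ i)"
    by (rule eq_matI) (auto simp: s_def)
  have d2: "Matrix.mat m m (\<lambda>(l, j). ((of_int (snd (?v (Suc l))))\<^sup>2 :: complex) ^ j) =
      Matrix.mat m m (\<lambda>(l, i). (of_int (r (Suc l)))\<^sup>2 ^ i)"
    by (rule eq_matI) auto
  have "(\<Prod>l=1..m. kr_weight p (?v l)) =
      (\<Prod>l=1..m. (if k l \<le> 0 then - 1 else 1) * p powi ((s l)\<^sup>2 - (r l)\<^sup>2) * of_int (s l))"
    by (rule prod.cong) (auto simp: kr_weight_def s_def)
  also have "\<dots> = (\<Prod>l=1..m. if k l \<le> 0 then - 1 else 1) * (\<Prod>l=1..m. p powi ((s l)\<^sup>2 - (r l)\<^sup>2)) * (\<Prod>l=1..m. of_int (s l))"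
    by (simp only: prod.distrib)
  also have "(\<Prod>l=1..m. if k l \<le> 0 then - 1 else (1::complex)) = (- 1) ^ card {l\<in>{1..m}. k l \<le> 0}"
    by (subst prod.If_cases) (auto simp: Int_def)
  also have "(\<Prod>l=1..m. p powi ((s l)\<^sup>2 - (r l)\<^sup>2)) = p powi (\<Sum>l=1..m. (s l)\<^sup>2 - (r l)\<^sup>2)"
    by (induction m) (use p in \<open>auto simp: power_int_add\<close>)
  also have "(\<Sum>l=1..m. (s l)\<^sup>2 - (r l)\<^sup>2) = int (m\<^sup>2) + 2 * q_exponent m k r"
    unfolding two_times_q_exponent s_def by simp
  also have "p powi (int (m\<^sup>2) + 2 * q_exponent m k r) = p ^ (m\<^sup>2) * (p\<^sup>2) powi q_exponent m k r"
    using p by (simp add: power_int_add power_int_square del: of_nat_power)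
  finally have w: "(\<Prod>l=1..m. kr_weight p (?v l)) = (- 1) ^ card {l\<in>{1..m}. k l \<le> 0} *
     (p ^ (m\<^sup>2) * (p\<^sup>2) powi q_exponent m k r) * (\<Prod>l=1..m. of_int (s l))" .
  have "of_int (poly_factor m k r) = (\<Prod>l=1..m. of_int (s l)) *
     (\<Prod>(i, j)\<in>{(i, j). 1 \<le> i \<and> i < j \<and> j \<le> m}. ((of_int (s j))\<^sup>2 - (of_int (s i))\<^sup>2) * ((of_int (r j))\<^sup>2 - (of_int (r i))\<^sup>2) :: complex)"
    unfolding poly_factor_def of_int_mult of_int_prod
    by (intro arg_cong2[where f = "(*)"] prod.cong) (auto simp: s_def algebra_simps power2_eq_square)
  also have "\<dots> = (\<Prod>l=1..m. of_int (s l)) *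
     ((\<Prod>i<m. \<Prod>l<i. (of_int (s (Suc i)))\<^sup>2 - (of_int (s (Suc l)))\<^sup>2) * (\<Prod>i<m. \<Prod>l<i. (of_int (r (Suc i)))\<^sup>2 - (of_int (r (Suc l)))\<^sup>2))"
    unfolding prod_pairs_upper by (simp only: prod.distrib)
  finally show ?thesis
    unfolding vec_term_def d1 d2 w det_vandermonde q_term_def by (simp only: mult_ac)
qed

lemma has_sum_vec_term:
  assumes p: "p \<noteq> 0" "norm p < 1"
  shows "(vec_term m p has_sum fact m * (\<Prod>n<m. fact (2 * n + 1) * fact (2 * n)) *
     (p * triangle_series (p\<^sup>2) ^ 4) ^ (m\<^sup>2)) ({1..m} \<rightarrow>\<^sub>E same_sign)"
proof -
  let ?\<phi> = "\<lambda>i z. ((of_int (snd z + 2 * fst z - 1))\<^sup>2 :: complex) ^ i"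
  let ?\<chi> = "\<lambda>i z. ((of_int (snd z))\<^sup>2 :: complex) ^ i"
  have h: "((\<lambda>z. kr_weight p z * ?\<phi> i z * ?\<chi> j z) has_sum kron_moment p (2 * i + 1) (2 * j) / 2) same_sign" for i j
    using has_sum_kr_weight[OF p, of i j] by (simp add: case_prod_unfold)
  show ?thesis
    using andreief[where w = "kr_weight p" and \<phi> = ?\<phi> and \<chi> = ?\<chi> and G = same_sign and m = m, OF h[THEN has_sum_imp_summable]]
    unfolding h[THEN infsumI] det_kron_moment[OF p]
    by (simp add: vec_term_def[abs_def] mult.assoc)
qed

text \<open>Membership in \<open>same_sign\<close> forces \<open>r\<close> to share the sign pattern
  of \<open>k\<close>, so \<open>V\<close> needs to record only the latter.\<close>

lemma int_vecs_sign_bij: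
  fixes m :: nat and J :: "nat set"
  defines "V \<equiv> {v \<in> {1..m} \<rightarrow>\<^sub>E same_sign. {l \<in> {1..m}. fst (v l) \<le> 0} = J}"
  shows "bij_betw (\<lambda>(k, r). \<lambda>l\<in>{1..m}. (k l, r l)) (int_vecs_sign m J \<times> int_vecs_sign m J) V"
proof (rule bij_betwI[where g = "\<lambda>v. (\<lambda>l\<in>{1..m}. fst (v l), \<lambda>l\<in>{1..m}. snd (v l))"])
  show "(\<lambda>(k, r). \<lambda>l\<in>{1..m}. (k l, r l)) \<in> int_vecs_sign m J \<times> int_vecs_sign m J \<rightarrow> V"
  proof (clarify)
    fix k r assume kr: "k \<in> int_vecs_sign m J" "r \<in> int_vecs_sign m J"
    have "(k l, r l) \<in> same_sign" if "l \<in> {1..m}" for l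
    proof -
      have "k l \<le> 0 \<longleftrightarrow> r l \<le> 0" using kr that by (auto simp: int_vecs_sign_def)
      thus ?thesis by (auto simp: same_sign_def)
    qed
    thus "(\<lambda>l\<in>{1..m}. (k l, r l)) \<in> V"
      using kr by (auto simp: V_def int_vecs_sign_def)
  qed
  show "(\<lambda>v. (\<lambda>l\<in>{1..m}. fst (v l), \<lambda>l\<in>{1..m}. snd (v l))) \<in> V \<rightarrow> int_vecs_sign m J \<times> int_vecs_sign m J"
  proof
    fix v assume v: "v \<in> V"
    have "fst (v l) \<le> 0 \<longleftrightarrow> snd (v l) \<le> 0" if "l \<in> {1..m}" for l
    proof -
      have "v l \<in> same_sign" using v that by (auto simp: V_def)
      thus ?thesis by (auto simp: same_sign_def)
    qed
    thus "(\<lambda>l\<in>{1..m}. fst (v l), \<lambda>l\<in>{1..m}. snd (v l)) \<in> int_vecs_sign m J \<times> int_vecs_sign m J"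
      using v by (auto simp: V_def int_vecs_sign_def)
  qed
  show "(\<lambda>v. (\<lambda>l\<in>{1..m}. fst (v l), \<lambda>l\<in>{1..m}. snd (v l))) ((\<lambda>(k, r). \<lambda>l\<in>{1..m}. (k l, r l)) x) = x"
    if "x \<in> int_vecs_sign m J \<times> int_vecs_sign m J" for x
    using that by (auto simp: int_vecs_sign_def PiE_def extensional_def restrict_def fun_eq_iff)
  show "(\<lambda>(k, r). \<lambda>l\<in>{1..m}. (k l, r l)) (\<lambda>l\<in>{1..m}. fst (v l), \<lambda>l\<in>{1..m}. snd (v l)) = v" if "v \<in> V" for v
    using that by (auto simp: V_def PiE_def extensional_def restrict_def fun_eq_iff)
qed

text \<open>The sign patterns partition the functions into \<open>same_sign\<close>, so the
  alternating sum over \<open>J\<close> reassembles the full sum of \<open>vec_term\<close>. As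
  \<open>p\<close> is nonzero, the common factor \<open>p^(m^2)\<close> cancels.\<close>

lemma q_term_sum:
  fixes q :: complex
  assumes q: "q \<noteq> 0" "norm q < 1"
  shows "J \<subseteq> {1..m} \<Longrightarrow> (\<lambda>(k, r). q_term m q k r) summable_on (int_vecs_sign m J \<times> int_vecs_sign m J)" (is "_ \<Longrightarrow> ?A")
    and "(\<Sum>J \<in> Pow {1..m}. (-1) ^ card J *
              (\<Sum>\<^sub>\<infinity>(k, r) \<in> int_vecs_sign m J \<times> int_vecs_sign m J. q_term m q k r)) =
      fact m * (\<Prod>n<m. fact (2 * n + 1) * fact (2 * n)) * triangle_series q ^ (4 * m\<^sup>2)" (is ?B)
proof -
  define p where "p = csqrt q"
  have pq: "q = p\<^sup>2" by (simp add: p_def)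
  have p: "p \<noteq> 0" "norm p < 1" using q by (simp_all add: p_def norm_csqrt)
  define V where "V = (\<lambda>J. {v \<in> {1..m} \<rightarrow>\<^sub>E same_sign. {l \<in> {1..m}. fst (v l) \<le> 0} = J})"
  let ?S = "\<lambda>J. int_vecs_sign m J \<times> int_vecs_sign m J"
  let ?e = "\<lambda>(k, r). \<lambda>l\<in>{1..m}. (k l, r l) :: int \<times> int"
  have V: "(\<Union>J\<in>Pow {1..m}. V J) = {1..m} \<rightarrow>\<^sub>E same_sign"
  proof (intro equalityI subsetI)
    fix v assume "v \<in> {1..m} \<rightarrow>\<^sub>E same_sign"
    hence "v \<in> V {l \<in> {1..m}. fst (v l) \<le> 0}" unfolding V_def by blast
    thus "v \<in> (\<Union>J\<in>Pow {1..m}. V J)" by (rule UN_I[rotated]) blast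
  next
    fix v assume "v \<in> (\<Union>J\<in>Pow {1..m}. V J)"
    then obtain J where "v \<in> V J" by (rule UN_E)
    thus "v \<in> {1..m} \<rightarrow>\<^sub>E same_sign" unfolding V_def by blast
  qed
  have vs: "vec_term m p summable_on V J" for J
    by (rule summable_on_subset[OF has_sum_vec_term[OF p, THEN has_sum_imp_summable]]) (simp add: V_def)
  have ve: "vec_term m p (?e x) = (p ^ (m\<^sup>2) * (- 1) ^ card J) * (case x of (k, r) \<Rightarrow> q_term m q k r)" if "x \<in> ?S J" for x J
  proof -
    obtain k r where x: "x = (k, r)" by (cases x)
    have "J = {l \<in> {1..m}. k l \<le> 0}" using that by (simp add: x int_vecs_sign_def)
    thus ?thesis using vec_term_eq[OF p(1), of m k r] by (simp add: x pq)
  qed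
  have s: "(\<lambda>(k, r). q_term m q k r) summable_on ?S J" for J
  proof -
    have "(\<lambda>x. vec_term m p (?e x)) summable_on ?S J"
      using vs[of J] summable_on_reindex_bij_betw[OF int_vecs_sign_bij[of m J], of "vec_term m p"]
      by (simp add: V_def)
    also have "?this \<longleftrightarrow> (\<lambda>x. (p ^ (m\<^sup>2) * (- 1) ^ card J) * (case x of (k, r) \<Rightarrow> q_term m q k r)) summable_on ?S J"
      by (rule summable_on_cong) (rule ve)
    finally show ?thesis
      using p by (subst (asm) summable_on_cmult_right') auto
  qed
  thus "J \<subseteq> {1..m} \<Longrightarrow> ?A" by blast
  have i: "infsum (vec_term m p) (V J) = p ^ (m\<^sup>2) * ((- 1) ^ card J * (\<Sum>\<^sub>\<infinity>(k, r)\<in>?S J. q_term m q k r))" for J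
  proof -
    have "infsum (vec_term m p) (V J) = (\<Sum>\<^sub>\<infinity>x\<in>?S J. vec_term m p (?e x))"
      using infsum_reindex_bij_betw[OF int_vecs_sign_bij[of m J], of "vec_term m p"] by (simp add: V_def)
    also have "\<dots> = (\<Sum>\<^sub>\<infinity>x\<in>?S J. (p ^ (m\<^sup>2) * (- 1) ^ card J) * (case x of (k, r) \<Rightarrow> q_term m q k r))"
      by (rule infsum_cong) (rule ve)
    finally show ?thesis by (simp add: infsum_cmult_right' mult.assoc)
  qed
  have "p ^ (m\<^sup>2) * (\<Sum>J \<in> Pow {1..m}. (-1) ^ card J * (\<Sum>\<^sub>\<infinity>(k, r)\<in>?S J. q_term m q k r)) =
      (\<Sum>J \<in> Pow {1..m}. infsum (vec_term m p) (V J))"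
    by (simp only: i sum_distrib_left)
  also have "\<dots> = infsum (vec_term m p) (\<Union>J\<in>Pow {1..m}. V J)"
    using vs by (intro sum_infsum) (auto simp: V_def)
  also have "\<dots> = fact m * (\<Prod>n<m. fact (2 * n + 1) * fact (2 * n)) * (p * triangle_series q ^ 4) ^ (m\<^sup>2)"
    unfolding V pq by (rule infsumI[OF has_sum_vec_term[OF p]])
  also have "\<dots> = p ^ (m\<^sup>2) * (fact m * (\<Prod>n<m. fact (2 * n + 1) * fact (2 * n)) * triangle_series q ^ (4 * m\<^sup>2))"
    by (simp only: power_mult_distrib power_mult mult_ac)
  finally show ?B using p by simp
qed

text \<open>The quotient of the two products is the double factorial \<open>(2m-1)!!\<close>, and
  \<open>(2m-1)! = (2m-1)!! * 2^(m-1) * (m-1)!\<close>.\<close>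

lemma fact_prod_identity:
  assumes "m \<ge> 1"
  shows "fact (2 * m - 1) * (\<Prod>n<m. fact (2 * n)) = 2 ^ (m - 1) * fact (m - 1) * (\<Prod>n<m. fact (2 * n + 1) :: complex)"
  using assms
proof (induction m rule: dec_induct)
  case (step m)
  have 1: "fact (2 * Suc m - 1) = (2 * of_nat m + 1) * (2 * of_nat m) * (fact (2 * m - 1) :: complex)"
    using step.hyps by (cases m) (simp_all add: algebra_simps)
  have 2: "(fact m :: complex) = of_nat m * fact (m - 1)"
    using step.hyps by (cases m) simp_all
  have 3: "(2::complex) ^ m = 2 * 2 ^ (m - 1)"
    using step.hyps by (cases m) simp_all
  have 4: "fact (2 * m + 1) = (2 * of_nat m + 1) * (fact (2 * m) :: complex)"
    by (simp add: algebra_simps)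
  have "fact (2 * Suc m - 1) * (\<Prod>n<Suc m. fact (2 * n)) =
     (2 * of_nat m + 1) * (2 * of_nat m) * fact (2 * m) * (fact (2 * m - 1) * (\<Prod>n<m. fact (2 * n)) :: complex)"
    unfolding 1 by (simp add: mult_ac)
  also have "\<dots> = (2 * 2 ^ (m - 1)) * (of_nat m * fact (m - 1)) * ((\<Prod>n<m. fact (2 * n + 1)) * ((2 * of_nat m + 1) * fact (2 * m)))"
    unfolding step.IH by (simp only: mult_ac)
  also have "\<dots> = 2 ^ (Suc m - 1) * fact (Suc m - 1) * (\<Prod>n<Suc m. fact (2 * n + 1))"
    by (simp only: 2[symmetric] 3[symmetric] 4[symmetric] diff_Suc_1 prod.lessThan_Suc)
  finally show ?case .
qed simp

lemma constant_eq:
  assumes "m \<ge> 1"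
  shows "fact (2 * m - 1) / (2 ^ (m - 1) * fact m * fact (m - 1) * (\<Prod>i=1..m. fact (2 * i - 1))\<^sup>2) *
    (fact m * (\<Prod>n<m. fact (2 * n + 1) * fact (2 * n))) = (1 :: complex)"
proof -
  define P where "P = (\<Prod>n<m. fact (2 * n + 1) :: complex)"
  have "P \<noteq> 0" by (simp add: P_def del: fact_Suc)
  have "(\<Prod>i=1..m. fact (2 * i - 1)) = P"
    unfolding P_def by (simp add: prod.atLeast1_atMost_eq)
  moreover have "(\<Prod>n<m. fact (2 * n + 1) * fact (2 * n)) = P * (\<Prod>n<m. fact (2 * n))"
    unfolding P_def by (rule prod.distrib)
  moreover have "fact (2 * m - 1) * (\<Prod>n<m. fact (2 * n)) = 2 ^ (m - 1) * fact (m - 1) * P"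
    unfolding P_def by (rule fact_prod_identity[OF assms])
  ultimately show ?thesis
    using \<open>P \<noteq> 0\<close> by (simp add: field_simps power2_eq_square)
qed

section \<open>Nonnegative exponents and the point \<open>q = 0\<close>\<close>

lemma sum_odd_ge_card_square:
  fixes A :: "int set"
  assumes "finite A" "\<And>x. x \<in> A \<Longrightarrow> x \<ge> 1"
  shows "(int (card A))\<^sup>2 \<le> (\<Sum>x\<in>A. 2 * x - 1)"
  using assms
proof (induction A rule: finite_linorder_max_induct)
  case (insert b A)
  have "A \<subseteq> {1..b - 1}" using insert by force
  hence "card A \<le> card {1..b - 1}" by (intro card_mono) auto
  \<comment> \<open>Hence the new term \<open>2 * b - 1\<close> is at least
    \<open>2 * card A + 1\<close>, the increment of the square.\<close>
  hence "int (card A) \<le> b - 1" using insert.prems[of b] by simp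
  moreover have "b \<notin> A" using insert by auto
  ultimately show ?case
    using insert by (simp add: power2_eq_square algebra_simps)
qed simp

text \<open>A nonzero polynomial factor makes the integers \<open>|r_l + 2 k_l - 1|\<close>
  distinct. They exceed \<open>|r_l|\<close>, so each difference of squares is at least
  \<open>2 * s l - 1\<close>, and m distinct positive integers give a total of at least
  \<open>1 + 3 + ... + (2m-1) = m^2\<close>.\<close>

lemma q_exponent_nonneg:
  assumes k: "k \<in> int_vecs_sign m J" and r: "r \<in> int_vecs_sign m J" and "poly_factor m k r \<noteq> 0"
  shows "q_exponent m k r \<ge> 0"
proof -
  define s where "s = (\<lambda>l. \<bar>r l + 2 * k l - 1\<bar>)"
  have rs: "\<bar>r l\<bar> < s l" if "l \<in> {1..m}" for l
  proof -
    have "k l \<le> 0 \<longleftrightarrow> r l \<le> 0" using k r that by (auto simp: int_vecs_sign_def)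
    thus ?thesis by (auto simp: s_def)
  qed
  have fin: "finite {(i, j). 1 \<le> i \<and> i < j \<and> j \<le> m}"
    by (rule finite_subset[of _ "{1..m} \<times> {1..m}"]) auto
  have ne: "s i \<noteq> s j" if "1 \<le> i" "i < j" "j \<le> m" for i j
  proof -
    let ?P = "{(i, j). 1 \<le> i \<and> i < j \<and> j \<le> m}"
    let ?h = "\<lambda>(i, j). (r i - r j) * (r i + r j) *
        (r i + 2 * k i - r j - 2 * k j) * (r i + 2 * k i + r j + 2 * k j - 2)"
    have "prod ?h ?P \<noteq> 0" using assms(3) by (simp add: poly_factor_def)
    moreover have "(i, j) \<in> ?P" using that by simp
    ultimately have "?h (i, j) \<noteq> 0" using fin by (meson prod_zero)
    thus ?thesis unfolding s_def by auto
  qed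
  have inj: "inj_on s {1..m}"
  proof (rule inj_onI)
    fix i j assume "i \<in> {1..m}" "j \<in> {1..m}" "s i = s j"
    thus "i = j" using ne[of i j] ne[of j i] by (cases i j rule: linorder_cases) auto
  qed
  have "(int m)\<^sup>2 \<le> (\<Sum>x\<in>s ` {1..m}. 2 * x - 1)"
    using sum_odd_ge_card_square[of "s ` {1..m}"] rs inj by (fastforce simp: card_image)
  also have "\<dots> = (\<Sum>l=1..m. 2 * s l - 1)"
    using inj by (simp add: sum.reindex)
  also have "\<dots> \<le> (\<Sum>l=1..m. (r l + 2 * k l - 1)\<^sup>2 - (r l)\<^sup>2)"
  proof (rule sum_mono)
    fix l assume "l \<in> {1..m}"
    from rs[OF this] have "(r l)\<^sup>2 \<le> (s l - 1)\<^sup>2" by (subst abs_le_square_iff[symmetric]) auto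
    moreover have "(r l + 2 * k l - 1)\<^sup>2 = (s l)\<^sup>2" by (simp add: s_def)
    ultimately show "2 * s l - 1 \<le> (r l + 2 * k l - 1)\<^sup>2 - (r l)\<^sup>2"
      by (simp add: power2_eq_square algebra_simps)
  qed
  finally show ?thesis using two_times_q_exponent[of m k r] by simp
qed

lemma triangle_series_tendsto_1: "(triangle_series \<longlongrightarrow> 1) (at 0)"
proof -
  have "((\<lambda>q. \<psi> q / 2) \<longlongrightarrow> 2 / 2) (at 0)" by (intro tendsto_intros \<psi>_tendsto_2) auto
  moreover have "\<forall>\<^sub>F q in at 0. \<psi> q / 2 = triangle_series q"
    unfolding eventually_at by (rule exI[of _ 1]) (auto simp: \<psi>_eq_triangle_series)
  ultimately show ?thesis by (simp add: tendsto_cong)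
qed

lemma triangle_series_0: "triangle_series 0 = 1"
proof -
  have "(\<lambda>n. 0 ^ (n * (n + 1) div 2)) = (\<lambda>n. if n = 0 then 1 else 0 :: complex)"
  proof
    fix n :: nat
    show "0 ^ (n * (n + 1) div 2) = (if n = 0 then 1 else 0 :: complex)"
      by (cases n) auto
  qed
  thus ?thesis unfolding triangle_series_def using sums_single[of 0 "\<lambda>_. 1 :: complex"]
    by (simp add: sums_iff)
qed

lemma q_term_summable:
  assumes "norm q < 1" "J \<subseteq> {1..m}"
  shows "(\<lambda>(k, r). q_term m q k r) summable_on (int_vecs_sign m J \<times> int_vecs_sign m J)"
proof (cases "q = 0")
  case False
  thus ?thesis using q_term_sum(1) assms by blast
next
  case True
  let ?S = "int_vecs_sign m J \<times> int_vecs_sign m J"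
  have "(\<lambda>(k, r). q_term m (complex_of_real (1/2)) k r) summable_on ?S"
    using q_term_sum(1)[OF half_in_unit_disc] assms by blast
  hence *: "(\<lambda>x. norm (case x of (k, r) \<Rightarrow> q_term m (complex_of_real (1/2)) k r)) summable_on ?S"
    by (simp only: summable_on_iff_abs_summable_on_complex)
  show ?thesis
  proof (rule abs_summable_summable[OF Infinite_Sum.abs_summable_on_comparison_test'[OF *]])
    fix x assume "x \<in> ?S"
    \<comment> \<open>At \<open>q = 0\<close> only the terms of exponent 0 remain, and there both
      sides agree.\<close>
    thus "norm (case x of (k, r) \<Rightarrow> q_term m q k r) \<le> norm (case x of (k, r) \<Rightarrow> q_term m (complex_of_real (1/2)) k r)"
      using True by (auto simp: q_term_def power_int_0_left_if)
  qed
qed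

lemma q_term_tendsto:
  assumes "J \<subseteq> {1..m}"
  shows "((\<lambda>q. \<Sum>\<^sub>\<infinity>(k, r) \<in> int_vecs_sign m J \<times> int_vecs_sign m J. q_term m q k r) \<longlongrightarrow>
     (\<Sum>\<^sub>\<infinity>(k, r) \<in> int_vecs_sign m J \<times> int_vecs_sign m J. q_term m 0 k r)) (at 0)"
proof -
  let ?S = "int_vecs_sign m J \<times> int_vecs_sign m J"
  let ?c = "\<lambda>(k, r). of_int (poly_factor m k r) :: complex" and ?e = "\<lambda>(k, r). q_exponent m k r"
  have eq: "(\<lambda>(k, r). q_term m q k r) = (\<lambda>x. ?c x * q powi ?e x)" for q
    by (auto simp: q_term_def mult_ac)
  show ?thesis unfolding eq
  proof (rule tendsto_infsum_powi)
    show "?e x \<ge> 0" if "x \<in> ?S" "?c x \<noteq> 0" for x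
      using that q_exponent_nonneg[of _ m J] by auto
    show "(\<lambda>x. ?c x * complex_of_real (1/2) powi ?e x) summable_on ?S"
      using q_term_sum(1)[OF half_in_unit_disc assms] unfolding eq .
  qed simp
qed

theorem theorem5p15:
  fixes m :: nat and q :: complex
  assumes "m \<ge> 1" and "norm q < 1"
  shows "(\<forall>J \<in> Pow {1..m}.
            (\<lambda>(k, r). q_term m q k r) summable_on (int_vecs_sign m J \<times> int_vecs_sign m J)) \<and>
         triangle_series q ^ (4 * m\<^sup>2) =
           fact (2 * m - 1) /
             (2 ^ (m - 1) * fact m * fact (m - 1) * (\<Prod>i=1..m. fact (2 * i - 1))\<^sup>2) *
           (\<Sum>J \<in> Pow {1..m}. (-1) ^ card J *
              (\<Sum>\<^sub>\<infinity>(k, r) \<in> int_vecs_sign m J \<times> int_vecs_sign m J. q_term m q k r))"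
proof
  show "\<forall>J \<in> Pow {1..m}.
      (\<lambda>(k, r). q_term m q k r) summable_on (int_vecs_sign m J \<times> int_vecs_sign m J)"
    using q_term_summable[OF assms(2)] by blast
  define c :: complex where "c = fact (2 * m - 1) /
             (2 ^ (m - 1) * fact m * fact (m - 1) * (\<Prod>i=1..m. fact (2 * i - 1))\<^sup>2)"
  define R where "R = (\<lambda>q. c * (\<Sum>J \<in> Pow {1..m}. (-1) ^ card J *
              (\<Sum>\<^sub>\<infinity>(k, r) \<in> int_vecs_sign m J \<times> int_vecs_sign m J. q_term m q k r)))"
  have nz: "R q = triangle_series q ^ (4 * m\<^sup>2)" if "q \<noteq> 0" "norm q < 1" for q
  proof -
    have "R q = (c * (fact m * (\<Prod>n<m. fact (2 * n + 1) * fact (2 * n)))) * triangle_series q ^ (4 * m\<^sup>2)"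
      unfolding R_def q_term_sum(2)[OF that] by (simp only: mult.assoc)
    thus ?thesis using constant_eq[OF assms(1)] by (simp add: c_def)
  qed
  have "triangle_series q ^ (4 * m\<^sup>2) = R q"
  proof (cases "q = 0")
    case True
    have "(R \<longlongrightarrow> R 0) (at 0)"
      unfolding R_def by (intro tendsto_intros q_term_tendsto) auto
    moreover have "((\<lambda>q. triangle_series q ^ (4 * m\<^sup>2)) \<longlongrightarrow> 1 ^ (4 * m\<^sup>2)) (at 0)"
      by (intro tendsto_intros triangle_series_tendsto_1)
    moreover have "\<forall>\<^sub>F q in at 0. triangle_series q ^ (4 * m\<^sup>2) = R q"
      unfolding eventually_at by (rule exI[of _ 1]) (auto simp: nz)
    ultimately have "R 0 = 1 ^ (4 * m\<^sup>2)"
      using tendsto_cong tendsto_unique[OF at_neq_bot] by fast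
    thus ?thesis unfolding True triangle_series_0 by simp
  qed (use nz assms in auto)
  thus "triangle_series q ^ (4 * m\<^sup>2) =
           fact (2 * m - 1) /
             (2 ^ (m - 1) * fact m * fact (m - 1) * (\<Prod>i=1..m. fact (2 * i - 1))\<^sup>2) *
           (\<Sum>J \<in> Pow {1..m}. (-1) ^ card J *
              (\<Sum>\<^sub>\<infinity>(k, r) \<in> int_vecs_sign m J \<times> int_vecs_sign m J. q_term m q k r))"
    by (simp only: R_def c_def)
qed

end
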